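(* Let $G$ be a Polish group with ample generic elements. Then $G$ has the small index property.
   Context: A Polish group $G$ has ample generic elements if for each finite $n\ge 1$ there is a comeager orbit for the diagonal conjugacy action of $G$ on $G^n$, $g\cdot(g_1,\dots,g_n)=(gg_1g^{-1},\dots,gg_ng^{-1})$. A second countable topological group has the small index property if every subgroup of index $<2^{\aleph_0}$ is open. *)

theory Defs
  imports "HOL-Analysis.Analysis" "HOL-Algebra.Group_Action" "HOL-Library.Equipollence"
begin

locale topological_group = group G for G (structure) +
  fixes T :: "'a topology"
  assumes topspace_eq: "topspace T = carrier G"
    and continuous_mult: "continuous_map (prod_topology T T) T (\<lambda>(x, y). x \<otimes> y)"
    and continuous_inv: "continuous_map T T (\<lambda>x. inv x)"

locale polish_group = topological_group +
  assumes completely_metrizable: "completely_metrizable_space T"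
    and separable: "separable_space T"

text \<open>The infix syntax for the topological closure clashes with the one of \<open>HOL-Algebra\<close>, hence
  the qualified name.\<close>

definition nowhere_dense_in :: "'a topology \<Rightarrow> 'a set \<Rightarrow> bool" where
  "nowhere_dense_in X A \<longleftrightarrow>
     A \<subseteq> topspace X \<and> X interior_of (Abstract_Topology.closure_of X A) = {}"

definition meager_in :: "'a topology \<Rightarrow> 'a set \<Rightarrow> bool" where
  "meager_in X A \<longleftrightarrow> (\<exists>\<N>. countable \<N> \<and> (\<forall>N\<in>\<N>. nowhere_dense_in X N) \<and> A = \<Union>\<N>)"

definition comeager_in :: "'a topology \<Rightarrow> 'a set \<Rightarrow> bool" where
  "comeager_in X A \<longleftrightarrow> A \<subseteq> topspace X \<and> meager_in X (topspace X - A)"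

text \<open>Elements of \<open>G\<^sup>n\<close> are extensional functions on \<open>{..<n}\<close>.\<close>

abbreviation tuples :: "('a, 'b) monoid_scheme \<Rightarrow> nat \<Rightarrow> (nat \<Rightarrow> 'a) set" where
  "tuples G n \<equiv> {..<n} \<rightarrow>\<^sub>E carrier G"

definition diag_conj :: "('a, 'b) monoid_scheme \<Rightarrow> nat \<Rightarrow> 'a \<Rightarrow> (nat \<Rightarrow> 'a) \<Rightarrow> nat \<Rightarrow> 'a" where
  "diag_conj G n g =
     (\<lambda>x \<in> tuples G n. \<lambda>i \<in> {..<n}. g \<otimes>\<^bsub>G\<^esub> x i \<otimes>\<^bsub>G\<^esub> inv\<^bsub>G\<^esub> g)"

lemma (in group) diag_conj_action: "group_action G (tuples G n) (diag_conj G n)"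
proof -
  have app: "diag_conj G n g x = (\<lambda>i\<in>{..<n}. g \<otimes> x i \<otimes> inv g)" if "x \<in> tuples G n" for g x
    unfolding diag_conj_def using that by (rule restrict_apply')
  have mem: "x i \<in> carrier G" if "x \<in> tuples G n" "i < n" for x i
    using that by (blast dest: PiE_mem)
  have closed: "diag_conj G n g x \<in> tuples G n" if "g \<in> carrier G" "x \<in> tuples G n" for g x
    unfolding app[OF that(2)] using that(1) mem[OF that(2)]
    by (intro restrict_PiE_iff[THEN iffD2]) simp
  have one: "diag_conj G n \<one> x = x" if x: "x \<in> tuples G n" for x
  proof
    show "diag_conj G n \<one> x i = x i" for i
      using mem[OF x, of i] PiE_arb[OF x, of i] by (cases "i < n") (simp_all add: app[OF x])
  qed
  have comp: "diag_conj G n (g \<otimes> h) x = diag_conj G n g (diag_conj G n h x)"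
    if gh: "g \<in> carrier G" "h \<in> carrier G" and x: "x \<in> tuples G n" for g h x
  proof
    show "diag_conj G n (g \<otimes> h) x i = diag_conj G n g (diag_conj G n h x) i" for i
      unfolding app[OF closed[OF gh(2) x]] unfolding app[OF x]
      using gh mem[OF x, of i] by (cases "i < n") (simp_all add: m_assoc inv_mult_group)
  qed
  have bij: "diag_conj G n g \<in> Bij (tuples G n)" if g: "g \<in> carrier G" for g
  proof -
    have "bij_betw (diag_conj G n g) (tuples G n) (tuples G n)"
    proof (rule bij_betw_byWitness[where f' = "diag_conj G n (inv g)"])
      show "\<forall>x\<in>tuples G n. diag_conj G n (inv g) (diag_conj G n g x) = x"
        using comp[of "inv g" g] one g by (metis inv_closed l_inv)
      show "\<forall>x\<in>tuples G n. diag_conj G n g (diag_conj G n (inv g) x) = x"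
        using comp[of g "inv g"] one g by (metis inv_closed r_inv)
      show "diag_conj G n g ` tuples G n \<subseteq> tuples G n"
        using closed[OF g] by (rule image_subsetI)
      show "diag_conj G n (inv g) ` tuples G n \<subseteq> tuples G n"
        using closed[OF inv_closed[OF g]] by (rule image_subsetI)
    qed
    moreover have "diag_conj G n g \<in> extensional (tuples G n)"
      unfolding diag_conj_def by (rule restrict_extensional)
    ultimately show ?thesis
      unfolding Bij_def by blast
  qed
  have "diag_conj G n \<in> hom G (BijGroup (tuples G n))"
  proof (rule homI)
    show "diag_conj G n g \<in> carrier (BijGroup (tuples G n))" if "g \<in> carrier G" for g
      using bij[OF that] unfolding BijGroup_def partial_object.simps .
  next
    fix g h assume gh: "g \<in> carrier G" "h \<in> carrier G"
    have "diag_conj G n (g \<otimes> h) x = compose (tuples G n) (diag_conj G n g) (diag_conj G n h) x"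
      for x
    proof (cases "x \<in> tuples G n")
      case True
      show ?thesis
        unfolding compose_eq[OF True] by (rule comp[OF gh True])
    next
      case False
      show ?thesis
        unfolding diag_conj_def compose_def restrict_def if_not_P[OF False] ..
    qed
    then show "diag_conj G n (g \<otimes> h) = diag_conj G n g \<otimes>\<^bsub>BijGroup (tuples G n)\<^esub> diag_conj G n h"
      unfolding BijGroup_def monoid.simps restrict_apply'[OF bij[OF gh(1)]]
        restrict_apply'[OF bij[OF gh(2)]] by (rule ext)
  qed
  then show ?thesis
    by (intro group_action.intro group_hom.intro group_hom_axioms.intro is_group group_BijGroup)
qed

definition ample_generics :: "('a, 'b) monoid_scheme \<Rightarrow> 'a topology \<Rightarrow> bool" where
  "ample_generics G T \<longleftrightarrow>
     (\<forall>n\<ge>1. \<exists>\<O> \<in> orbits G (tuples G n) (diag_conj G n).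
        comeager_in (product_topology (\<lambda>_. T) {..<n}) \<O>)"

text \<open>The index of \<open>H\<close> is the cardinality of the set of its cosets; it is compared with
  \<open>2\<^sup>\<aleph>\<^sup>0\<close>, the cardinality of the set of all sets of natural numbers, by strict domination, since
  \<^const>\<open>card\<close> is of no use for infinite sets.\<close>

definition small_index_property :: "('a, 'b) monoid_scheme \<Rightarrow> 'a topology \<Rightarrow> bool" where
  "small_index_property G T \<longleftrightarrow>
     (\<forall>H. subgroup H G \<and> rcosets\<^bsub>G\<^esub> H \<prec> (UNIV :: nat set set) \<longrightarrow> openin T H)"

end

theory Submission
  imports Defs
begin

text \<open>Suppose that a subgroup \<open>H\<close> of a Polish group \<open>G\<close> with ample generics is not open. Continuum
  many right cosets of \<open>H\<close> are exhibited by elements \<open>p a\<close>, indexed by the sets \<open>a\<close> of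
  natural numbers, with \<open>p a \<otimes> inv (p b) \<notin> H\<close> whenever \<open>a \<noteq> b\<close>.

  If \<open>H\<close> is meager, cover it by a meager \<open>F\<^sub>\<sigma>\<close> set and take the infinite products of
  subsequences of one sequence that tends to \<open>\<one>\<close> fast and is chosen by the Baire category
  theorem such that quotients of distinct finite products avoid that set
  (\<open>meager_subgroup_continuum_index\<close>).

  If \<open>H\<close> is not meager, then, \<open>H\<close> not being open, its complement is not meager in any
  nonempty open set (\<open>subgroup_open_if_comeager_in_open\<close>). For arbitrary \<open>A\<close> and \<open>B\<close> with
  these two properties one builds elements \<open>p a\<close> such that for \<open>a \<noteq> b\<close> the conjugates
  \<open>inv (p a) \<otimes> A \<otimes> p a\<close> and \<open>inv (p b) \<otimes> B \<otimes> p b\<close> meet when the branch \<open>a\<close> leaves \<open>b\<close> on the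
  side of \<open>A\<close> (\<open>generic_tree\<close>). With \<open>A = H\<close> and \<open>B = G - H\<close> this forces the conjugates of
  \<open>H\<close> by \<open>p a\<close> and \<open>p b\<close> to differ, so \<open>p a\<close> and \<open>p b\<close> lie in different right cosets.

  The tree is where ample generics enter. A node of height \<open>n\<close> carries a group element \<open>h\<close>
  and a generic \<open>n\<close>-tuple \<open>x\<close>, one in the comeager orbit. By the Kuratowski-Ulam theorem
  comeagerly many one-point extensions of \<open>x\<close> are generic too (\<open>comeager_orbit_section\<close>), so
  there is one by some \<open>y \<in> A\<close>. All generic extensions are conjugate, and by Effros' theorem
  those close to \<open>x\<close> extended by \<open>y\<close> are conjugate to it by an element \<open>v\<close> close to \<open>\<one>\<close>. As
  \<open>B\<close> is large in every open set, the extension by some \<open>z \<in> B\<close> is among them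
  (\<open>generic_tuple_extension\<close>). The two successors of the node carry \<open>h\<close> with the tuple
  extended by \<open>y\<close>, and \<open>v \<otimes> h\<close> with the tuple extended by \<open>z\<close>. Since \<open>v\<close> commutes with the
  entries of \<open>x\<close>, what was arranged at earlier nodes is preserved, and since \<open>v\<close> is as small
  as desired, the group elements converge along every branch.\<close>

section \<open>Baire category\<close>

lemma closure_of_meets:
  assumes "x \<in> Abstract_Topology.closure_of X S" and "openin X U" and "x \<in> U"
  obtains y where "y \<in> S" "y \<in> U"
  using assms by (auto simp: in_closure_of)

text \<open>Meager sets form a \<open>\<sigma>\<close>-ideal that is invariant under homeomorphisms.\<close>

lemma nowhere_dense_in_subset:
  assumes "nowhere_dense_in X B" and "A \<subseteq> B"
  shows "nowhere_dense_in X A"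
  using assms interior_of_mono[OF closure_of_mono[OF assms(2), of X], of X]
  unfolding nowhere_dense_in_def by auto

lemma nowhere_dense_imp_meager_in: "nowhere_dense_in X A \<Longrightarrow> meager_in X A"
  unfolding meager_in_def by (rule exI[of _ "{A}"]) auto

lemma meager_in_subset:
  assumes "meager_in X B" and "A \<subseteq> B"
  shows "meager_in X A"
proof -
  obtain \<N> where "countable \<N>" "\<forall>N\<in>\<N>. nowhere_dense_in X N" "B = \<Union>\<N>"
    using assms(1) unfolding meager_in_def by blast
  then show ?thesis
    unfolding meager_in_def using assms(2)
    by (intro exI[of _ "(\<lambda>N. N \<inter> A) ` \<N>"]) (auto intro: nowhere_dense_in_subset)
qed

lemma meager_in_Union:
  assumes "countable \<A>" and "\<And>A. A \<in> \<A> \<Longrightarrow> meager_in X A"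
  shows "meager_in X (\<Union>\<A>)"
proof -
  obtain F where F: "\<And>A. A \<in> \<A> \<Longrightarrow> countable (F A) \<and> (\<forall>N\<in>F A. nowhere_dense_in X N) \<and> A = \<Union>(F A)"
    using assms(2) unfolding meager_in_def by metis
  have "\<Union>\<A> = (\<Union>A\<in>\<A>. \<Union>(F A))"
    using F by (intro SUP_cong[of _ _ "\<lambda>A. A", simplified]) blast+
  also have "\<dots> = \<Union>(\<Union>(F ` \<A>))"
    by blast
  finally show ?thesis
    unfolding meager_in_def using assms(1) F
    by (intro exI[of _ "\<Union>(F ` \<A>)"]) auto
qed

lemma meager_in_UN:
  assumes "countable I" and "\<And>i. i \<in> I \<Longrightarrow> meager_in X (A i)"
  shows "meager_in X (\<Union>i\<in>I. A i)"
  using meager_in_Union[of "A ` I" X] assms by auto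

lemma meager_in_Un:
  assumes "meager_in X A" and "meager_in X B"
  shows "meager_in X (A \<union> B)"
  using meager_in_Union[of "{A, B}" X] assms by auto

lemma meager_in_homeomorphic_image:
  assumes f: "homeomorphic_map X Y f" and A: "meager_in X A"
  shows "meager_in Y (f ` A)"
proof -
  obtain \<N> where N: "countable \<N>" "\<forall>N\<in>\<N>. nowhere_dense_in X N" "A = \<Union>\<N>"
    using A unfolding meager_in_def by blast
  have "nowhere_dense_in Y (f ` N)" if "N \<in> \<N>" for N
  proof -
    have N': "N \<subseteq> topspace X" "X interior_of (Abstract_Topology.closure_of X N) = {}"
      using N(2) that unfolding nowhere_dense_in_def by auto
    have "f ` N \<subseteq> topspace Y"
      using f N'(1) homeomorphic_imp_surjective_map by blast
    then show ?thesis
      unfolding nowhere_dense_in_def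
      by (simp add: homeomorphic_map_closure_of[OF f N'(1)]
          homeomorphic_map_interior_of[OF f closure_of_subset_topspace] N'(2))
  qed
  then show ?thesis
    unfolding meager_in_def using N by (intro exI[of _ "(`) f ` \<N>"]) auto
qed

text \<open>The cover is by closed sets, so that a point off the cover has a neighborhood off any given
  member; it increases, so that only late members have to be avoided.\<close>

lemma meager_in_cover_closed:
  assumes "meager_in X A"
  obtains F :: "nat \<Rightarrow> 'a set"
  where "\<And>n. closedin X (F n)" "incseq F" "A \<subseteq> (\<Union>n. F n)" "meager_in X (\<Union>n. F n)"
proof -
  obtain \<N> where N: "countable \<N>" "\<forall>N\<in>\<N>. nowhere_dense_in X N" "A = \<Union>\<N>"
    using assms unfolding meager_in_def by blast
  have emp: "nowhere_dense_in X {}"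
    by (simp add: nowhere_dense_in_def)
  \<comment> \<open>The empty set is added because \<open>\<N>\<close> itself may be empty.\<close>
  define g where "g = from_nat_into (insert {} \<N>)"
  have rng: "range g = insert {} \<N>"
    unfolding g_def using N(1) by (intro range_from_nat_into) auto
  then have nd: "nowhere_dense_in X (g i)" for i
    using N(2) emp by (metis insert_iff rangeI)
  define C where "C i = Abstract_Topology.closure_of X (g i)" for i
  have C: "meager_in X (C i)" "g i \<subseteq> C i" "closedin X (C i)" for i
    using nd[of i] unfolding C_def nowhere_dense_in_def
    by (auto intro!: nowhere_dense_imp_meager_in simp: nowhere_dense_in_def closure_of_subset
        closure_of_subset_topspace)
  show ?thesis
  proof (rule that[of "\<lambda>n. \<Union>i\<le>n. C i"])
    show "closedin X (\<Union>i\<le>n. C i)" for n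
      using C(3) by (intro closedin_Union) auto
    show "incseq (\<lambda>n. \<Union>i\<le>n. C i)"
      unfolding incseq_def by fastforce
    show "A \<subseteq> (\<Union>n. \<Union>i\<le>n. C i)"
    proof
      fix x assume "x \<in> A"
      then have "x \<in> \<Union>(range g)"
        using N(3) unfolding rng by auto
      then obtain i where "x \<in> C i"
        using C(2) by auto
      then show "x \<in> (\<Union>n. \<Union>i\<le>n. C i)"
        by auto
    qed
    show "meager_in X (\<Union>n. \<Union>i\<le>n. C i)"
      using C(1) by (intro meager_in_UN) auto
  qed
qed

lemma openin_not_meager_in:
  assumes "completely_metrizable_space X" and "openin X U" and "U \<noteq> {}"
  shows "\<not> meager_in X U"
proof
  assume "meager_in X U"
  then obtain \<N> where N: "countable \<N>" "\<forall>N\<in>\<N>. nowhere_dense_in X N" "U = \<Union>\<N>"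
    unfolding meager_in_def by blast
  have "X interior_of \<Union>(Abstract_Topology.closure_of X ` \<N>) = {}"
    using assms(1) N(1,2) unfolding nowhere_dense_in_def
    by (intro Baire_category_alt) auto
  moreover have "U \<subseteq> \<Union>(Abstract_Topology.closure_of X ` \<N>)"
    using N(2,3) closure_of_subset unfolding nowhere_dense_in_def by fastforce
  ultimately show False
    using assms(2,3) interior_of_maximal by blast
qed

lemma comeager_in_Int_not_meager:
  assumes "comeager_in X C" and "\<not> meager_in X A" "A \<subseteq> topspace X"
  shows "A \<inter> C \<noteq> {}"
proof
  assume "A \<inter> C = {}"
  then have "A \<subseteq> topspace X - C"
    using assms(3) by blast
  then show False
    using assms(1,2) meager_in_subset unfolding comeager_in_def by blast
qed

lemma separable_metrizable_imp_second_countable: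
  assumes "metrizable_space X" and "separable_space X"
  shows "second_countable X"
proof -
  obtain M d where "Metric_space M d" and X: "X = Metric_space.mtopology M d"
    using assms(1) unfolding metrizable_space_def by blast
  interpret Metric_space M d by fact
  obtain C where C: "countable C" "C \<subseteq> M" "Abstract_Topology.closure_of X C = M"
    using assms(2) unfolding separable_space_def X by auto
  define \<B> where "\<B> = (\<lambda>(c, n). mball c (1 / Suc n)) ` (C \<times> (UNIV :: nat set))"
  have "\<exists>V\<in>\<B>. x \<in> V \<and> V \<subseteq> U" if U: "openin X U" "x \<in> U" for U x
  proof -
    obtain r where r: "r > 0" "mball x r \<subseteq> U" "x \<in> M"
      using U unfolding X openin_mtopology by blast
    obtain n :: nat where n: "1 / Suc n < r / 2"
      using r(1) nat_approx_posE half_gt_zero by blast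
    have "x \<in> Abstract_Topology.closure_of X C"
      using r(3) C(3) by simp
    then obtain c where c: "c \<in> C" "c \<in> mball x (1 / Suc n)"
      unfolding X metric_closure_of by (smt (verit) mem_Collect_eq of_nat_0_less_iff zero_less_Suc zero_less_divide_1_iff)
    have "mball c (1 / Suc n) \<subseteq> mball x r"
    proof
      fix y assume y: "y \<in> mball c (1 / Suc n)"
      then show "y \<in> mball x r"
        using c n r(3) triangle[of x c y] by auto
    qed
    moreover have "x \<in> mball c (1 / Suc n)"
      using c commute by auto
    ultimately show ?thesis
      using r(2) c(1) unfolding \<B>_def by blast
  qed
  moreover have "countable \<B>" "\<forall>V\<in>\<B>. openin X V"
    unfolding \<B>_def X using C(1) by auto
  ultimately show ?thesis
    unfolding second_countable_def by blast
qed

text \<open>The nowhere dense case of the Kuratowski-Ulam theorem. Let \<open>F\<close> be the closure of \<open>N\<close>. If the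
  section of \<open>N\<close> at \<open>x\<close> is not nowhere dense, then the section of \<open>F\<close> contains a nonempty
  basic open set \<open>B\<close>. For fixed \<open>B\<close> the set of such \<open>x\<close> is closed, since projections are
  open, and has empty interior, since otherwise \<open>F\<close> would contain an open box; and there are
  only countably many \<open>B\<close>.\<close>

lemma nowhere_dense_in_prod_section:
  assumes Y: "second_countable Y" and N: "nowhere_dense_in (prod_topology X Y) N"
  shows "meager_in X {x \<in> topspace X. \<not> nowhere_dense_in Y {y. (x, y) \<in> N}}"
proof -
  let ?P = "prod_topology X Y"
  obtain \<B> where B: "countable \<B>" "\<And>V. V \<in> \<B> \<Longrightarrow> openin Y V"
      "\<And>U y. openin Y U \<Longrightarrow> y \<in> U \<Longrightarrow> \<exists>V\<in>\<B>. y \<in> V \<and> V \<subseteq> U"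
    using Y unfolding second_countable_def by metis
  define F where "F = Abstract_Topology.closure_of ?P N"
  have NP: "N \<subseteq> topspace X \<times> topspace Y" and F: "closedin ?P F" "?P interior_of F = {}" "N \<subseteq> F"
    using N closure_of_subset[of N ?P] unfolding nowhere_dense_in_def F_def by auto
  have F_top: "F \<subseteq> topspace X \<times> topspace Y"
    using closedin_subset[OF F(1)] by simp
  define Z where "Z B = {x \<in> topspace X. {x} \<times> B \<subseteq> F}" for B
  have Z: "nowhere_dense_in X (Z B)" if B': "B \<in> \<B> - {{}}" for B
  proof -
    have opB: "openin Y B" "B \<noteq> {}"
      using B' B(2) by auto
    have "fst ` (topspace X \<times> B - F) = topspace X - Z B"
      unfolding Z_def by force
    moreover have "openin ?P (topspace X \<times> B - F)"
      using opB F(1) by (intro openin_diff) (auto simp: openin_prod_Times_iff)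
    ultimately have "openin X (topspace X - Z B)"
      using open_map_fst[of X Y] unfolding open_map_def by metis
    moreover have sub: "Z B \<subseteq> topspace X"
      unfolding Z_def by auto
    ultimately have cl: "closedin X (Z B)"
      by (simp add: closedin_def)
    let ?W = "X interior_of Z B"
    have "?W \<times> B \<subseteq> F"
      using interior_of_subset[of X "Z B"] unfolding Z_def by auto
    moreover have "openin ?P (?W \<times> B)"
      using opB by (simp add: openin_prod_Times_iff)
    ultimately have "?W \<times> B \<subseteq> ?P interior_of F"
      by (rule interior_of_maximal)
    then have "?W = {}"
      using F(2) opB(2) by blast
    then show ?thesis
      unfolding nowhere_dense_in_def using sub cl closure_of_closedin by metis
  qed
  have "{x \<in> topspace X. \<not> nowhere_dense_in Y {y. (x, y) \<in> N}} \<subseteq> (\<Union>B\<in>\<B> - {{}}. Z B)"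
  proof clarsimp
    fix x assume x: "x \<in> topspace X" and "\<not> nowhere_dense_in Y {y. (x, y) \<in> N}"
    moreover have "{y. (x, y) \<in> N} \<subseteq> topspace Y"
      using NP by auto
    ultimately obtain y where y: "y \<in> Y interior_of (Abstract_Topology.closure_of Y {y. (x, y) \<in> N})"
      unfolding nowhere_dense_in_def by blast
    have "closedin Y {y \<in> topspace Y. (x, y) \<in> F}"
      using F(1) x by (intro closedin_continuous_map_preimage[of Y ?P "\<lambda>y. (x, y)"])
        (auto simp: continuous_map_pairwise o_def)
    moreover have "{y. (x, y) \<in> N} \<subseteq> {y \<in> topspace Y. (x, y) \<in> F}"
      using F(3) NP by auto
    ultimately have "Abstract_Topology.closure_of Y {y. (x, y) \<in> N} \<subseteq> {y \<in> topspace Y. (x, y) \<in> F}"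
      by (meson closure_of_minimal)
    moreover obtain B' where "B' \<in> \<B>" "y \<in> B'"
        "B' \<subseteq> Y interior_of (Abstract_Topology.closure_of Y {y. (x, y) \<in> N})"
      using B(3)[OF openin_interior_of y] by blast
    ultimately have "{x} \<times> B' \<subseteq> F" "B' \<in> \<B> - {{}}"
      using interior_of_subset by fastforce+
    then show "\<exists>B\<in>\<B> - {{}}. x \<in> Z B"
      using x unfolding Z_def by blast
  qed
  moreover have "meager_in X (\<Union>B\<in>\<B> - {{}}. Z B)"
    using B(1) Z by (intro meager_in_UN nowhere_dense_imp_meager_in) auto
  ultimately show ?thesis
    by (rule meager_in_subset[rotated])
qed

lemma Kuratowski_Ulam_meager:
  assumes Y: "second_countable Y" and E: "meager_in (prod_topology X Y) E"
  shows "meager_in X {x \<in> topspace X. \<not> meager_in Y {y. (x, y) \<in> E}}"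
proof -
  obtain \<N> where N: "countable \<N>" "\<forall>N\<in>\<N>. nowhere_dense_in (prod_topology X Y) N" "E = \<Union>\<N>"
    using E unfolding meager_in_def by blast
  have "{x \<in> topspace X. \<not> meager_in Y {y. (x, y) \<in> E}}
      \<subseteq> (\<Union>N\<in>\<N>. {x \<in> topspace X. \<not> nowhere_dense_in Y {y. (x, y) \<in> N}})"
  proof clarsimp
    fix x assume x: "x \<in> topspace X" and nm: "\<not> meager_in Y {y. (x, y) \<in> E}"
    have "{y. (x, y) \<in> E} = (\<Union>N\<in>\<N>. {y. (x, y) \<in> N})"
      using N(3) by auto
    then show "\<exists>N\<in>\<N>. \<not> nowhere_dense_in Y {y. (x, y) \<in> N}"
      using nm N(1) meager_in_UN nowhere_dense_imp_meager_in by metis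
  qed
  moreover have "meager_in X (\<Union>N\<in>\<N>. {x \<in> topspace X. \<not> nowhere_dense_in Y {y. (x, y) \<in> N}})"
    using N Y by (intro meager_in_UN nowhere_dense_in_prod_section) auto
  ultimately show ?thesis
    by (rule meager_in_subset[rotated])
qed

section \<open>Sequences with halving steps\<close>

text \<open>The bound is \<open>r n\<close> at every stage, not just at the start: limits of different sequences are
  later kept apart by closed balls whose radii are fixed during the construction of the
  sequences.\<close>

lemma (in Metric_space) halving_steps_converge:
  assumes "mcomplete" and x: "\<And>n. x n \<in> M" and r0: "\<And>n. 0 \<le> r n"
    and r: "\<And>n. r (Suc n) \<le> r n / 2"
    and step: "\<And>n. d (x n) (x (Suc n)) \<le> r n / 2"
  obtains l where "limitin mtopology x l sequentially" "\<And>n. d (x n) l \<le> r n"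
proof -
  have dist: "d (x n) (x (n + k)) \<le> r n" for n k
  proof (induction k arbitrary: n)
    case 0
    then show ?case using x r0 by simp
  next
    case (Suc k)
    have "d (x n) (x (n + Suc k)) \<le> d (x n) (x (Suc n)) + d (x (Suc n)) (x (Suc n + k))"
      using triangle x by simp
    then show ?case
      using Suc.IH[of "Suc n"] step[of n] r[of n] by linarith
  qed
  have bound: "r n \<le> r 0 * (1/2) ^ n" for n
  proof (induction n)
    case (Suc n)
    then show ?case using r[of n] by simp
  qed simp
  have "(\<lambda>n. r 0 * (1/2) ^ n) \<longlonglongrightarrow> r 0 * 0"
    by (intro tendsto_intros LIMSEQ_power_zero) simp
  then have "r \<longlonglongrightarrow> 0"
    using r0 bound by (intro tendsto_sandwich[of "\<lambda>_. 0" r _ "\<lambda>n. r 0 * (1/2) ^ n"]) auto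
  have "MCauchy x"
    unfolding MCauchy_def
  proof (intro conjI allI impI)
    fix e :: real assume "0 < e"
    then obtain N where N: "r N < e / 2"
      using \<open>r \<longlonglongrightarrow> 0\<close> by (metis half_gt_zero order_tendstoD(2) eventually_sequentially order_refl)
    have "d (x n) (x m) < e" if "N \<le> n" "N \<le> m" for n m
    proof -
      have "d (x N) (x n) \<le> r N" "d (x N) (x m) \<le> r N"
        using dist[of N "n - N"] dist[of N "m - N"] that by auto
      moreover have "d (x n) (x m) \<le> d (x n) (x N) + d (x N) (x m)"
        using triangle x by simp
      ultimately show ?thesis
        using N commute[of "x n" "x N"] by linarith
    qed
    then show "\<exists>N. \<forall>n n'. N \<le> n \<longrightarrow> N \<le> n' \<longrightarrow> d (x n) (x n') < e"
      by blast
  qed (use x in auto)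
  then obtain l where l: "limitin mtopology x l sequentially"
    using \<open>mcomplete\<close> unfolding mcomplete_def by blast
  moreover have "d (x n) l \<le> r n" for n
  proof -
    have "eventually (\<lambda>m. x m \<in> mcball (x n) (r n)) sequentially"
      using dist[of n] x le_Suc_ex by (auto simp: eventually_sequentially intro!: exI[of _ n])
         (metis le_Suc_ex)
    then show ?thesis
      using limitin_closedin[OF l closedin_mcball] by (metis in_mcball trivial_limit_sequentially)
  qed
  ultimately show ?thesis
    using that by blast
qed

section \<open>Subgroups of a Polish group and category\<close>

text \<open>It suffices to separate \<open>p a\<close> from \<open>p b\<close> in the order given by the first point of
  difference, because \<open>H\<close> is closed under inversion.\<close>

lemma (in group) continuum_many_rcosets:
  fixes p :: "nat set \<Rightarrow> 'a"
  assumes H: "subgroup H G" and p: "\<And>a. p a \<in> carrier G"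
    and sep: "\<And>a b n. n \<in> a \<Longrightarrow> n \<notin> b \<Longrightarrow> (\<And>i. i < n \<Longrightarrow> i \<in> a \<longleftrightarrow> i \<in> b) \<Longrightarrow> p a \<otimes> inv (p b) \<notin> H"
  shows "\<not> rcosets H \<prec> (UNIV :: nat set set)"
proof -
  have "p a \<otimes> inv (p b) \<notin> H" if "a \<noteq> b" for a b
  proof -
    define n where "n = (LEAST n. (n \<in> a) \<noteq> (n \<in> b))"
    have "\<exists>n. (n \<in> a) \<noteq> (n \<in> b)"
      using that by blast
    then have n: "(n \<in> a) \<noteq> (n \<in> b)"
      unfolding n_def by (rule LeastI_ex[of "\<lambda>n. (n \<in> a) \<noteq> (n \<in> b)"])
    have below: "i \<in> a \<longleftrightarrow> i \<in> b" if "i < n" for i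
      using not_less_Least[OF that[unfolded n_def]] by blast
    show ?thesis
    proof (cases "n \<in> a")
      case True
      then show ?thesis using n sep below by blast
    next
      case False
      then have "p b \<otimes> inv (p a) \<notin> H"
        using n sep[of n b a] below by blast
      moreover have "inv (p a \<otimes> inv (p b)) = p b \<otimes> inv (p a)"
        using p by (simp add: inv_mult_group)
      ultimately show ?thesis
        using subgroup.m_inv_closed[OF H, of "p a \<otimes> inv (p b)"] by auto
    qed
  qed
  moreover have "p a \<otimes> inv (p b) \<in> H" if eq: "H #> p a = H #> p b" for a b
  proof -
    have "p a \<in> H #> p b"
      using rcos_self[OF p H, of a] eq by simp
    then obtain h where h: "h \<in> H" "p a = h \<otimes> p b"
      unfolding r_coset_def by auto
    then have "p a \<otimes> inv (p b) = h"
      using subgroup.mem_carrier[OF H h(1)] p[of b] by (simp add: m_assoc)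
    then show ?thesis
      using h(1) by simp
  qed
  ultimately have "inj (\<lambda>a. H #> p a)"
    by (meson injI)
  moreover have "range (\<lambda>a. H #> p a) \<subseteq> rcosets H"
    using p unfolding RCOSETS_def by auto
  ultimately have "(UNIV :: nat set set) \<lesssim> rcosets H"
    unfolding lepoll_def by blast
  then show ?thesis
    using lepoll_antisym lesspoll_def by blast
qed

context topological_group
begin

lemma continuous_map_group_mult:
  assumes "continuous_map X T f" and "continuous_map X T g"
  shows "continuous_map X T (\<lambda>x. f x \<otimes> g x)"
  using continuous_map_compose[OF _ continuous_mult, of X "\<lambda>x. (f x, g x)"] assms
  by (simp add: o_def continuous_map_paired)

lemma continuous_map_group_inv:
  assumes "continuous_map X T f"
  shows "continuous_map X T (\<lambda>x. inv (f x))"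
  using continuous_map_compose[OF assms continuous_inv] by (simp add: o_def)

lemma homeomorphic_map_two_sided_mult:
  assumes "a \<in> carrier G" and "b \<in> carrier G"
  shows "homeomorphic_map T T (\<lambda>x. a \<otimes> x \<otimes> b)"
proof -
  have c: "continuous_map T T (\<lambda>x. u \<otimes> x \<otimes> v)" if "u \<in> carrier G" "v \<in> carrier G" for u v
    using that by (intro continuous_map_group_mult) (auto simp: topspace_eq)
  have "homeomorphic_maps T T (\<lambda>x. a \<otimes> x \<otimes> b) (\<lambda>x. inv a \<otimes> x \<otimes> inv b)"
    unfolding homeomorphic_maps_def using c assms
    by (auto simp: topspace_eq m_assoc) (simp_all flip: m_assoc)
  then show ?thesis
    using homeomorphic_map_maps by blast
qed

lemma homeomorphic_map_group_inv: "homeomorphic_map T T (\<lambda>x. inv x)"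
proof -
  have "homeomorphic_maps T T (\<lambda>x. inv x) (\<lambda>x. inv x)"
    unfolding homeomorphic_maps_def using continuous_inv by (auto simp: topspace_eq)
  then show ?thesis
    using homeomorphic_map_maps by blast
qed

lemma homeomorphic_map_left_mult:
  assumes "a \<in> carrier G"
  shows "homeomorphic_map T T (\<lambda>x. a \<otimes> x)"
  using assms
  by (intro homeomorphic_map_eq[OF homeomorphic_map_two_sided_mult[OF assms one_closed]])
    (auto simp: topspace_eq)

lemma openin_group_preimage:
  assumes "continuous_map T T f" and "openin T U"
  shows "openin T {x \<in> carrier G. f x \<in> U}"
  using openin_continuous_map_preimage[OF assms] by (simp add: topspace_eq)

lemma continuous_map_left_mult [simp]: "a \<in> carrier G \<Longrightarrow> continuous_map T T (\<lambda>x. a \<otimes> x)"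
  by (intro continuous_map_group_mult) (auto simp: topspace_eq)

lemma continuous_map_right_mult [simp]: "a \<in> carrier G \<Longrightarrow> continuous_map T T (\<lambda>x. x \<otimes> a)"
  by (intro continuous_map_group_mult) (auto simp: topspace_eq)

lemma nhds_of_continuous_map2:
  assumes f: "continuous_map (prod_topology T T) T (\<lambda>(x, y). f x y)"
    and "openin T U" and "a \<in> carrier G" "b \<in> carrier G" "f a b \<in> U"
  obtains V W where "openin T V" "a \<in> V" "openin T W" "b \<in> W" "\<And>x y. x \<in> V \<Longrightarrow> y \<in> W \<Longrightarrow> f x y \<in> U"
proof -
  let ?N = "{z \<in> topspace (prod_topology T T). (case z of (x, y) \<Rightarrow> f x y) \<in> U}"
  have "openin (prod_topology T T) ?N"
    using openin_continuous_map_preimage[OF f assms(2)] .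
  moreover have "(a, b) \<in> ?N"
    using assms(3-5) by (simp add: topspace_eq)
  ultimately obtain V W where VW: "openin T V" "openin T W" "a \<in> V" "b \<in> W" "V \<times> W \<subseteq> ?N"
    unfolding openin_prod_topology_alt by meson
  show ?thesis
  proof (rule that[OF VW(1,3,2,4)])
    show "f x y \<in> U" if "x \<in> V" "y \<in> W" for x y
      using subsetD[OF VW(5), of "(x, y)"] that by simp
  qed
qed

lemma continuous_map_mult_inv: "continuous_map (prod_topology T T) T (\<lambda>(x, y). x \<otimes> inv y)"
  unfolding case_prod_beta
  by (intro continuous_map_group_mult continuous_map_group_inv continuous_map_fst continuous_map_snd)

lemma continuous_map_inv_mult: "continuous_map (prod_topology T T) T (\<lambda>(x, y). inv x \<otimes> y)"
  unfolding case_prod_beta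
  by (intro continuous_map_group_mult continuous_map_group_inv continuous_map_fst continuous_map_snd)

lemma subgroup_open_if_nhd:
  assumes H: "subgroup H G" and W: "openin T W" "\<one> \<in> W" "W \<subseteq> H"
  shows "openin T H"
proof (subst openin_subopen, intro ballI)
  fix h assume h: "h \<in> H"
  then have hc: "h \<in> carrier G"
    using subgroup.mem_carrier[OF H] by blast
  let ?U = "{x \<in> carrier G. inv h \<otimes> x \<in> W}"
  have "openin T ?U"
    using hc W(1) by (intro openin_group_preimage) auto
  moreover have "h \<in> ?U"
    using hc W(2) by simp
  moreover have "?U \<subseteq> H"
  proof
    fix x assume x: "x \<in> ?U"
    then have "h \<otimes> (inv h \<otimes> x) \<in> H"
      using W(3) subgroup.m_closed[OF H h] by blast
    then show "x \<in> H"
      using hc x by (simp add: inv_solve_left' flip: m_assoc)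
  qed
  ultimately show "\<exists>U. openin T U \<and> h \<in> U \<and> U \<subseteq> H"
    by blast
qed

end

context polish_group
begin

lemma complete_metric:
  obtains d where "Metric_space (carrier G) d" "Metric_space.mcomplete (carrier G) d"
    "T = Metric_space.mtopology (carrier G) d"
proof -
  obtain M d where Md: "Metric_space M d" "Metric_space.mcomplete M d" "T = Metric_space.mtopology M d"
    using completely_metrizable unfolding completely_metrizable_space_def by blast
  moreover have "M = carrier G"
    using Metric_space.topspace_mtopology[OF Md(1)] Md(3) topspace_eq by simp
  ultimately show ?thesis
    using that by blast
qed

text \<open>Pettis' argument. Fix \<open>u \<in> U\<close>. If \<open>g\<close> is so close to \<open>\<one>\<close> that \<open>g \<otimes> u \<in> U\<close>, then the open set
  \<open>U \<inter> gU\<close> is not empty; as \<open>H\<close> is comeager in \<open>U\<close> and \<open>gH\<close> in \<open>gU\<close>, the cosets \<open>H\<close> and \<open>gH\<close>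
  meet, that is, \<open>g \<in> H\<close>.\<close>

lemma subgroup_open_if_comeager_in_open:
  assumes H: "subgroup H G" and U: "openin T U" "U \<noteq> {}" "meager_in T (U - H)"
  shows "openin T H"
proof -
  obtain u where u: "u \<in> U" "u \<in> carrier G"
    using U openin_subset topspace_eq by fastforce
  define W where "W = {g \<in> carrier G. g \<otimes> u \<in> U}"
  have "openin T W"
    unfolding W_def using u U(1) by (intro openin_group_preimage) auto
  moreover have "\<one> \<in> W"
    unfolding W_def using u by simp
  moreover have "W \<subseteq> H"
  proof
    fix g assume "g \<in> W"
    then have g: "g \<in> carrier G" "g \<otimes> u \<in> U"
      unfolding W_def by auto
    show "g \<in> H"
    proof (rule ccontr)
      assume "g \<notin> H"
      let ?A = "U \<inter> {x \<in> carrier G. inv g \<otimes> x \<in> U}"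
      have "?A \<subseteq> (U - H) \<union> (\<lambda>x. g \<otimes> x) ` (U - H)"
      proof
        fix x assume x: "x \<in> ?A"
        have eq: "x = g \<otimes> (inv g \<otimes> x)"
          using x g(1) by (simp flip: m_assoc)
        have "inv g \<otimes> x \<notin> H" if "x \<in> H"
        proof
          assume "inv g \<otimes> x \<in> H"
          then have "x \<otimes> inv (inv g \<otimes> x) \<in> H"
            using H that by (simp add: subgroup.m_closed subgroup.m_inv_closed)
          also have "x \<otimes> inv (inv g \<otimes> x) = g"
            using x g(1) by (simp add: inv_mult_group flip: m_assoc)
          finally show False
            using \<open>g \<notin> H\<close> by simp
        qed
        then show "x \<in> (U - H) \<union> (\<lambda>x. g \<otimes> x) ` (U - H)"
          using x eq by blast
      qed
      moreover have "meager_in T ((U - H) \<union> (\<lambda>x. g \<otimes> x) ` (U - H))"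
        using U(3) meager_in_homeomorphic_image[OF homeomorphic_map_left_mult[OF g(1)] U(3)]
        by (rule meager_in_Un)
      ultimately have "meager_in T ?A"
        by (rule meager_in_subset[rotated])
      moreover have "openin T ?A"
        using U(1) g(1) by (intro openin_Int openin_group_preimage) auto
      moreover have "g \<otimes> u \<in> ?A"
        using g u by (simp flip: m_assoc)
      ultimately show False
        using openin_not_meager_in[OF completely_metrizable] by blast
    qed
  qed
  ultimately show ?thesis
    by (rule subgroup_open_if_nhd[OF H])
qed

end

section \<open>Meager subgroups have index continuum\<close>

definition (in group) right_separated :: "'a set \<Rightarrow> 'a set \<Rightarrow> bool" where
  "right_separated M S \<longleftrightarrow> (\<forall>P\<in>S. \<forall>Q\<in>S. P \<noteq> Q \<longrightarrow> P \<otimes> inv Q \<notin> M)"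

text \<open>Being separated from a closed set is an open condition, so finitely many points stay
  separated when they are moved a little.\<close>

lemma (in topological_group) right_separated_radius:
  assumes d: "Metric_space (carrier G) d" and T: "T = Metric_space.mtopology (carrier G) d"
    and F: "closedin T F" and S: "finite S" "S \<subseteq> carrier G" "right_separated F S" and r0: "0 < r0"
  obtains r where "0 < r" "r \<le> r0"
    "\<And>P Q x y. P \<in> S \<Longrightarrow> Q \<in> S \<Longrightarrow> P \<noteq> Q \<Longrightarrow> x \<in> carrier G \<Longrightarrow> y \<in> carrier G \<Longrightarrow>
      d P x \<le> r \<Longrightarrow> d Q y \<le> r \<Longrightarrow> x \<otimes> inv y \<notin> F"
proof -
  interpret d: Metric_space "carrier G" d by fact
  have "\<exists>r>0. \<forall>x\<in>d.mcball P r. \<forall>y\<in>d.mcball Q r. x \<otimes> inv y \<notin> F"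
    if PQ: "P \<in> S" "Q \<in> S" "P \<noteq> Q" for P Q
  proof -
    have PQc: "P \<in> carrier G" "Q \<in> carrier G"
      using PQ S(2) by blast+
    have "openin T (carrier G - F)"
      using F by (simp add: closedin_def topspace_eq)
    moreover have "P \<otimes> inv Q \<in> carrier G - F"
      using PQ PQc S(3) unfolding right_separated_def by simp
    ultimately obtain V W where VW: "openin T V" "P \<in> V" "openin T W" "Q \<in> W"
      "\<And>x y. x \<in> V \<Longrightarrow> y \<in> W \<Longrightarrow> x \<otimes> inv y \<in> carrier G - F"
      using nhds_of_continuous_map2[OF continuous_map_mult_inv _ PQc] by metis
    obtain r1 r2 where r: "r1 > 0" "d.mcball P r1 \<subseteq> V" "r2 > 0" "d.mcball Q r2 \<subseteq> W"
      using VW(1-4) unfolding T d.openin_mtopology_mcball by metis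
    have "d.mcball P (min r1 r2) \<subseteq> V" "d.mcball Q (min r1 r2) \<subseteq> W"
      using r by auto
    then have "\<forall>x\<in>d.mcball P (min r1 r2). \<forall>y\<in>d.mcball Q (min r1 r2). x \<otimes> inv y \<notin> F"
      using VW(5) by blast
    then show ?thesis
      using r(1,3) by (intro exI[of _ "min r1 r2"]) simp
  qed
  then obtain \<rho> where \<rho>: "\<And>P Q. P \<in> S \<Longrightarrow> Q \<in> S \<Longrightarrow> P \<noteq> Q \<Longrightarrow> \<rho> P Q > 0 \<and>
      (\<forall>x\<in>d.mcball P (\<rho> P Q). \<forall>y\<in>d.mcball Q (\<rho> P Q). x \<otimes> inv y \<notin> F)"
    by metis
  define A where "A = Set.filter (\<lambda>(P, Q). P \<noteq> Q) (S \<times> S)"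
  define r where "r = Min (insert r0 ((\<lambda>(P, Q). \<rho> P Q) ` A))"
  have fin: "finite (insert r0 ((\<lambda>(P, Q). \<rho> P Q) ` A))"
    using S(1) unfolding A_def by simp
  have pos: "0 < e" if "e \<in> insert r0 ((\<lambda>(P, Q). \<rho> P Q) ` A)" for e
    using that r0 \<rho> unfolding A_def by auto
  show ?thesis
  proof (rule that)
    show "0 < r"
      unfolding r_def using Min_in[OF fin] pos by blast
    show "r \<le> r0"
      unfolding r_def by (intro Min_le[OF fin]) simp
    fix P Q x y assume PQ: "P \<in> S" "Q \<in> S" "P \<noteq> Q" and xy: "x \<in> carrier G" "y \<in> carrier G"
      "d P x \<le> r" "d Q y \<le> r"
    have "(P, Q) \<in> A"
      using PQ unfolding A_def by simp
    then have "r \<le> \<rho> P Q"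
      unfolding r_def by (intro Min_le[OF fin]) force
    moreover have "P \<in> carrier G" "Q \<in> carrier G"
      using PQ S(2) by blast+
    ultimately have "x \<in> d.mcball P (\<rho> P Q)" "y \<in> d.mcball Q (\<rho> P Q)"
      using xy by simp_all
    then show "x \<otimes> inv y \<notin> F"
      using \<rho>[OF PQ] by blast
  qed
qed

text \<open>Each of the finitely many forbidden values of a quotient involving \<open>f\<close> excludes a
  homeomorphic copy of the meager set \<open>M\<close>. Putting \<open>f\<close> on the right matters: in a quotient
  of two new points \<open>P \<otimes> f\<close> and \<open>Q \<otimes> f\<close> it cancels, whereas \<open>inv f \<otimes> c \<otimes> f\<close>, as a function
  of \<open>f\<close>, need not pull meager sets back to meager sets.\<close>

lemma (in polish_group) right_separated_extend:
  assumes M: "M \<subseteq> carrier G" "\<one> \<in> M" "meager_in T M"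
    and S: "finite S" "S \<subseteq> carrier G" "right_separated M S"
    and V: "openin T V" "\<one> \<in> V"
  obtains f where "f \<in> V" "right_separated M (S \<union> (\<lambda>P. P \<otimes> f) ` S)"
    "\<And>P Q. P \<in> S \<Longrightarrow> Q \<in> S \<Longrightarrow> P \<otimes> f \<noteq> Q"
proof -
  have Sc: "P \<in> carrier G" if "P \<in> S" for P
    using that S(2) by blast
  have V': "\<not> meager_in T V" "V \<subseteq> carrier G"
    using openin_not_meager_in[OF completely_metrizable V(1)] V(2) openin_subset[OF V(1)] topspace_eq by auto
  \<comment> \<open>\<open>N\<close> collects the \<open>f\<close> with \<open>(P \<otimes> f) \<otimes> inv Q \<in> M\<close> or \<open>Q \<otimes> inv (P \<otimes> f) \<in> M\<close> for some \<open>P\<close> and \<open>Q\<close>.\<close>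
  define N where "N = (\<Union>P\<in>S. \<Union>Q\<in>S. (\<lambda>x. inv P \<otimes> x \<otimes> Q) ` M \<union>
    (\<lambda>x. inv P \<otimes> x \<otimes> Q) ` (\<lambda>x. inv x) ` M)"
  have "meager_in T ((\<lambda>x. inv P \<otimes> x \<otimes> Q) ` M)" "meager_in T ((\<lambda>x. inv P \<otimes> x \<otimes> Q) ` (\<lambda>x. inv x) ` M)"
    if "P \<in> S" "Q \<in> S" for P Q
    using homeomorphic_map_two_sided_mult[of "inv P" Q] Sc[OF that(1)] Sc[OF that(2)] M(3)
      meager_in_homeomorphic_image[OF homeomorphic_map_group_inv M(3)] meager_in_homeomorphic_image
    by (metis inv_closed)+
  then have "meager_in T N"
    unfolding N_def using countable_finite[OF S(1)] by (intro meager_in_UN meager_in_Un)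
  then obtain f where f: "f \<in> V" "f \<notin> N"
    using V' meager_in_subset by blast
  have fc: "f \<in> carrier G"
    using f(1) V'(2) by blast
  have 1: "(P \<otimes> f) \<otimes> inv Q \<notin> M" if PQ: "P \<in> S" "Q \<in> S" for P Q
  proof
    assume "(P \<otimes> f) \<otimes> inv Q \<in> M"
    moreover have "inv P \<otimes> ((P \<otimes> f) \<otimes> inv Q) \<otimes> Q = f"
      using fc Sc[OF PQ(1)] Sc[OF PQ(2)] by (simp add: m_assoc) (simp flip: m_assoc)
    ultimately show False
      using f(2) PQ unfolding N_def by (metis (no_types, lifting) UN_I UnI1 imageI)
  qed
  have 2: "Q \<otimes> inv (P \<otimes> f) \<notin> M" if PQ: "P \<in> S" "Q \<in> S" for P Q
  proof
    assume "Q \<otimes> inv (P \<otimes> f) \<in> M"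
    moreover have "inv P \<otimes> inv (Q \<otimes> inv (P \<otimes> f)) \<otimes> Q = f"
      using fc Sc[OF PQ(1)] Sc[OF PQ(2)]
      by (simp add: inv_mult_group m_assoc) (simp flip: m_assoc)
    ultimately show False
      using f(2) PQ unfolding N_def by (metis (no_types, lifting) UN_I UnI2 imageI)
  qed
  have 3: "(P \<otimes> f) \<otimes> inv (Q \<otimes> f) = P \<otimes> inv Q" if PQ: "P \<in> S" "Q \<in> S" for P Q
    using fc Sc[OF PQ(1)] Sc[OF PQ(2)] by (simp add: inv_mult_group m_assoc) (simp flip: m_assoc)
  show ?thesis
  proof (rule that[OF f(1)])
    show "P \<otimes> f \<noteq> Q" if PQ: "P \<in> S" "Q \<in> S" for P Q
      using 1[OF PQ] M(2) Sc[OF PQ(2)] by auto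
    show "right_separated M (S \<union> (\<lambda>P. P \<otimes> f) ` S)"
      unfolding right_separated_def
    proof (intro ballI impI)
      fix P Q assume PQ: "P \<in> S \<union> (\<lambda>P. P \<otimes> f) ` S" "Q \<in> S \<union> (\<lambda>P. P \<otimes> f) ` S" "P \<noteq> Q"
      then consider "P \<in> S" "Q \<in> S" | Q' where "P \<in> S" "Q' \<in> S" "Q = Q' \<otimes> f"
        | P' where "P' \<in> S" "P = P' \<otimes> f" "Q \<in> S"
        | P' Q' where "P' \<in> S" "P = P' \<otimes> f" "Q' \<in> S" "Q = Q' \<otimes> f"
        by blast
      then show "P \<otimes> inv Q \<notin> M"
      proof cases
        case 4
        then have "P' \<noteq> Q'"
          using PQ(3) by blast
        then show ?thesis
          using 4 3[of P' Q'] S(3) unfolding right_separated_def by simp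
      qed (use PQ(3) S(3) 1 2 in \<open>auto simp: right_separated_def\<close>)
    qed
  qed
qed

text \<open>Choose elements \<open>f 0\<close>, \<open>f 1\<close>, ... such that the finite set \<open>S n\<close> of all products of
  subsequences of \<open>f 0\<close>, ..., \<open>f (n - 1)\<close> is separated from the meager set \<open>M\<close>, and radii
  \<open>r n\<close> such that this persists for \<open>F n\<close> when the points move by \<open>r n\<close>. Each \<open>f n\<close> is taken
  so small that the infinite product along \<open>a\<close> stays within \<open>r n\<close> of its \<open>n\<close>-th partial
  product. Distinct infinite products then have a quotient outside all \<open>F n\<close> with large \<open>n\<close>,
  hence outside \<open>M \<supseteq> H\<close>.\<close>

lemma (in polish_group) meager_subgroup_continuum_index:
  assumes H: "subgroup H G" and mH: "meager_in T H"
  shows "\<not> rcosets H \<prec> (UNIV :: nat set set)"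
proof -
  obtain d where d: "Metric_space (carrier G) d" and compl: "Metric_space.mcomplete (carrier G) d"
    and T: "T = Metric_space.mtopology (carrier G) d"
    by (rule complete_metric)
  interpret d: Metric_space "carrier G" d by fact
  obtain F :: "nat \<Rightarrow> 'a set" where F: "\<And>n. closedin T (F n)" "incseq F" "H \<subseteq> (\<Union>n. F n)"
    "meager_in T (\<Union>n. F n)"
    using meager_in_cover_closed[OF mH] by metis
  define M where "M = (\<Union>n. F n)"
  have M: "M \<subseteq> carrier G" "\<one> \<in> M" "meager_in T M"
    using F closedin_subset[OF F(1)] subgroup.one_closed[OF H] unfolding M_def topspace_eq by auto
  define sep where "sep S \<longleftrightarrow> finite S \<and> S \<subseteq> carrier G \<and> right_separated M S" for S
  define rad where "rad n S r \<longleftrightarrow> 0 < r \<and> (\<forall>P\<in>S. \<forall>Q\<in>S. P \<noteq> Q \<longrightarrow>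
    (\<forall>x\<in>carrier G. \<forall>y\<in>carrier G. d P x \<le> r \<longrightarrow> d Q y \<le> r \<longrightarrow> x \<otimes> inv y \<notin> F n))" for n S r
  have ex_rad: "\<exists>r. rad n S r \<and> r \<le> r0" if S: "sep S" and r0: "0 < r0" for n S r0
  proof -
    have "right_separated (F n) S"
      using S unfolding sep_def right_separated_def M_def by blast
    then show ?thesis
      using right_separated_radius[OF d T F(1) _ _ _ r0, of S n] S unfolding rad_def sep_def
      by metis
  qed
  have ex_f: "\<exists>f\<in>carrier G. sep (S \<union> (\<lambda>P. P \<otimes> f) ` S) \<and> (\<forall>P\<in>S. \<forall>Q\<in>S. P \<otimes> f \<noteq> Q)
      \<and> (\<forall>P\<in>S. d P (P \<otimes> f) \<le> r / 2)" if S: "sep S" and r: "0 < r" for S r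
  proof -
    have S': "finite S" "S \<subseteq> carrier G" "right_separated M S"
      using S unfolding sep_def by blast+
    define V where "V = (\<Inter>P\<in>S. {f \<in> carrier G. P \<otimes> f \<in> d.mball P (r / 2)}) \<inter> carrier G"
    have "openin T {f \<in> carrier G. P \<otimes> f \<in> d.mball P (r / 2)}" if "P \<in> S" for P
      using that S'(2) by (intro openin_group_preimage) (auto simp: T[symmetric] intro: d.openin_mball[folded T])
    then have "openin T V"
      unfolding V_def topspace_eq[symmetric] by (rule openin_INT[OF S'(1)])
    moreover have "\<one> \<in> V"
      unfolding V_def using S'(2) r by auto
    ultimately obtain f where f: "f \<in> V" "right_separated M (S \<union> (\<lambda>P. P \<otimes> f) ` S)"
        "\<And>P Q. P \<in> S \<Longrightarrow> Q \<in> S \<Longrightarrow> P \<otimes> f \<noteq> Q"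
      using right_separated_extend[OF M S'] by metis
    have "f \<in> carrier G" "\<And>P. P \<in> S \<Longrightarrow> d P (P \<otimes> f) \<le> r / 2"
      using f(1) unfolding V_def by auto
    then show ?thesis
      unfolding sep_def using f(2,3) S' by (intro bexI[of _ f]) auto
  qed
  \<comment> \<open>A stage of the construction is a pair \<open>(S n, r n)\<close>.\<close>
  define step where "step x y f \<longleftrightarrow> f \<in> carrier G \<and> fst y = fst x \<union> (\<lambda>P. P \<otimes> f) ` fst x \<and>
    (\<forall>P\<in>fst x. \<forall>Q\<in>fst x. P \<otimes> f \<noteq> Q) \<and> (\<forall>P\<in>fst x. d P (P \<otimes> f) \<le> snd x / 2) \<and> snd y \<le> snd x / 2"
    for x y :: "'a set \<times> real" and f
  have "\<exists>s. \<forall>n. (sep (fst (s n)) \<and> rad n (fst (s n)) (snd (s n)) \<and> (n = 0 \<longrightarrow> fst (s n) = {\<one>}))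
      \<and> (\<exists>f. step (s n) (s (Suc n)) f)"
  proof (rule dependent_nat_choice)
    have "sep {\<one>}"
      unfolding sep_def right_separated_def by simp
    then show "\<exists>x. sep (fst x) \<and> rad 0 (fst x) (snd x) \<and> (0 = (0::nat) \<longrightarrow> fst x = {\<one>})"
      using ex_rad[of "{\<one>}" 1 0] by (metis fst_conv snd_conv zero_less_one)
  next
    fix x and n :: nat
    assume x: "sep (fst x) \<and> rad n (fst x) (snd x) \<and> (n = 0 \<longrightarrow> fst x = {\<one>})"
    then have r: "snd x > 0"
      unfolding rad_def by blast
    obtain f where f: "f \<in> carrier G" "sep (fst x \<union> (\<lambda>P. P \<otimes> f) ` fst x)"
      "\<forall>P\<in>fst x. \<forall>Q\<in>fst x. P \<otimes> f \<noteq> Q" "\<forall>P\<in>fst x. d P (P \<otimes> f) \<le> snd x / 2"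
      using ex_f[of "fst x" "snd x"] x r by blast
    obtain r' where "rad (Suc n) (fst x \<union> (\<lambda>P. P \<otimes> f) ` fst x) r'" "r' \<le> snd x / 2"
      using ex_rad[OF f(2), of "snd x / 2" "Suc n"] r by auto
    then show "\<exists>y. (sep (fst y) \<and> rad (Suc n) (fst y) (snd y) \<and> (Suc n = 0 \<longrightarrow> fst y = {\<one>}))
      \<and> (\<exists>f. step x y f)"
      using f unfolding step_def
      by (intro exI[of _ "(fst x \<union> (\<lambda>P. P \<otimes> f) ` fst x, r')"]) auto
  qed
  then obtain s f where s: "\<And>n. sep (fst (s n))" "\<And>n. rad n (fst (s n)) (snd (s n))" "fst (s 0) = {\<one>}"
    and f: "\<And>n. step (s n) (s (Suc n)) (f n)"
    by metis
  define S r where "S n = fst (s n)" and "r n = snd (s n)" for n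
  define p where "p a = rec_nat \<one> (\<lambda>n x. if n \<in> a then x \<otimes> f n else x)" for a :: "nat set"
  have p0: "p a 0 = \<one>" and pS: "p a (Suc n) = (if n \<in> a then p a n \<otimes> f n else p a n)" for a n
    unfolding p_def by simp_all
  have p_in: "p a n \<in> S n" for a n
  proof (induction n)
    case 0
    show ?case using s(3) by (simp add: p0 S_def)
  next
    case (Suc n)
    then show ?case using f[of n] unfolding step_def by (simp add: pS S_def)
  qed
  have p_carrier: "p a n \<in> carrier G" for a n
    using p_in[of a n] s(1)[of n] unfolding sep_def S_def by blast
  have r_pos: "0 < r n" and r_half: "r (Suc n) \<le> r n / 2" for n
    using s(2)[of n] f[of n] unfolding rad_def step_def r_def by auto
  have p_step: "d (p a n) (p a (Suc n)) \<le> r n / 2" for a n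
    using f[of n] p_in[of a n] r_pos[of n] p_carrier[of a n] unfolding step_def by (simp add: pS S_def r_def)
  have "\<exists>l. limitin d.mtopology (p a) l sequentially \<and> (\<forall>n. d (p a n) l \<le> r n)" for a
    using d.halving_steps_converge[OF compl, of "p a" r] p_carrier r_pos r_half p_step
    by (metis less_imp_le)
  then obtain l where l: "\<And>a. limitin d.mtopology (p a) (l a) sequentially" "\<And>a n. d (p a n) (l a) \<le> r n"
    by metis
  have l_carrier: "l a \<in> carrier G" for a
    using l(1) d.limitin_mspace by blast
  show ?thesis
  proof (rule continuum_many_rcosets[OF H l_carrier])
    fix a b :: "nat set" and n
    assume n: "n \<in> a" "n \<notin> b" and below: "\<And>i. i < n \<Longrightarrow> i \<in> a \<longleftrightarrow> i \<in> b"
    have eq: "p a m = p b m" if "m \<le> n" for m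
      using that by (induction m) (auto simp: p0 pS below)
    have neq: "p a m \<noteq> p b m" if "Suc n \<le> m" for m
      using that
    proof (induction m rule: dec_induct)
      case base
      then show ?case
        using f[of n] p_in[of a n] n eq[of n] unfolding step_def by (auto simp: pS S_def)
    next
      case (step m)
      have fc: "f m \<in> carrier G"
        using f[of m] unfolding step_def by blast
      have "p a m \<otimes> f m \<noteq> p b m" "p b m \<otimes> f m \<noteq> p a m"
        using f[of m] p_in[of a m] p_in[of b m] unfolding step_def S_def by auto
      moreover have "p a m \<otimes> f m \<noteq> p b m \<otimes> f m"
        using step fc p_carrier by simp
      ultimately show ?case
        using step by (auto simp: pS)
    qed
    have notF: "l a \<otimes> inv (l b) \<notin> F m" if "Suc n \<le> m" for m
      using l_carrier l(2) s(2)[of m] neq[OF that] p_in[of a m] p_in[of b m]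
      unfolding rad_def S_def r_def by blast
    have "l a \<otimes> inv (l b) \<notin> F k" for k
      using notF[of "max k (Suc n)"] incseqD[OF F(2), of k "max k (Suc n)"] by auto
    then show "l a \<otimes> inv (l b) \<notin> H"
      using F(3) by blast
  qed
qed

section \<open>Orbit maps of Polish group actions are open\<close>

locale polish_action = polish_group +
  fixes X :: "'c topology" and \<phi> :: "'a \<Rightarrow> 'c \<Rightarrow> 'c"
  assumes action: "group_action G (topspace X) \<phi>"
    and continuous_action: "continuous_map (prod_topology T X) X (\<lambda>(g, x). \<phi> g x)"
begin

lemma act_closed: "g \<in> carrier G \<Longrightarrow> x \<in> topspace X \<Longrightarrow> \<phi> g x \<in> topspace X"
  using group_action.element_image[OF action] by blast

lemma act_one: "x \<in> topspace X \<Longrightarrow> \<phi> \<one> x = x"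
  using group_action.id_eq_one[OF action] by (metis restrict_apply')

lemma act_act:
  assumes "g \<in> carrier G" and "h \<in> carrier G" and "x \<in> topspace X"
  shows "\<phi> g (\<phi> h x) = \<phi> (g \<otimes> h) x"
  using group_action.composition_rule[OF action assms(3,1,2)] by simp

lemma homeomorphic_map_act:
  assumes g: "g \<in> carrier G"
  shows "homeomorphic_map X X (\<phi> g)"
proof -
  have c: "continuous_map X X (\<phi> h)" if "h \<in> carrier G" for h
    using continuous_map_compose[OF _ continuous_action, of X "\<lambda>y. (h, y)"] that
    by (simp add: o_def continuous_map_pairwise topspace_eq)
  have "homeomorphic_maps X X (\<phi> g) (\<phi> (inv g))"
    unfolding homeomorphic_maps_def using c g by (simp add: act_act act_one)
  then show ?thesis
    using homeomorphic_map_maps by blast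
qed

lemma continuous_map_orbit_map:
  assumes "x \<in> topspace X"
  shows "continuous_map T X (\<lambda>g. \<phi> g x)"
  using continuous_map_compose[OF _ continuous_action, of T "\<lambda>g. (g, x)"] assms
  by (simp add: o_def continuous_map_pairwise)

lemma orbit_subset: "\<O> \<in> orbits G (topspace X) \<phi> \<Longrightarrow> \<O> \<subseteq> topspace X"
  using act_closed unfolding orbits_def orbit_def by auto

lemma orbit_closed:
  assumes "\<O> \<in> orbits G (topspace X) \<phi>" and "g \<in> carrier G" and "y \<in> \<O>"
  shows "\<phi> g y \<in> \<O>"
proof -
  obtain w h where "w \<in> topspace X" "\<O> = {\<phi> g w | g. g \<in> carrier G}" "h \<in> carrier G" "y = \<phi> h w"
    using assms(1,3) unfolding orbits_def orbit_def by auto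
  then show ?thesis
    using assms(2) by (auto simp: act_act)
qed

lemma orbit_transitive:
  assumes "\<O> \<in> orbits G (topspace X) \<phi>" and "y \<in> \<O>" and "z \<in> \<O>"
  obtains g where "g \<in> carrier G" "z = \<phi> g y"
proof -
  obtain w a b where w: "w \<in> topspace X" "a \<in> carrier G" "b \<in> carrier G" "y = \<phi> a w" "z = \<phi> b w"
    using assms unfolding orbits_def orbit_def by auto
  then have "z = \<phi> (b \<otimes> inv a) y"
    by (simp add: act_act m_assoc)
  then show ?thesis
    using w that by blast
qed

text \<open>If \<open>W'\<close> is a neighborhood of \<open>\<one>\<close> with \<open>inv W' \<otimes> W' \<subseteq> W\<close>, then countably many translates of
  \<open>W' y\<close> cover the nonmeager orbit, so the closure of \<open>W' y\<close> has an interior point of the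
  form \<open>w y\<close> with \<open>w \<in> W'\<close>. Applying \<open>inv w\<close> moves it to \<open>y\<close>.\<close>

lemma orbit_map_nearly_open:
  assumes O: "\<O> \<in> orbits G (topspace X) \<phi>" "\<not> meager_in X \<O>" "y \<in> \<O>"
    and W: "openin T W" "\<one> \<in> W"
  shows "y \<in> X interior_of (Abstract_Topology.closure_of X ((\<lambda>g. \<phi> g y) ` W))"
proof -
  have yX: "y \<in> topspace X"
    using O orbit_subset by blast
  obtain V1 V2 where V12: "openin T V1" "\<one> \<in> V1" "openin T V2" "\<one> \<in> V2"
    "\<And>a b. a \<in> V1 \<Longrightarrow> b \<in> V2 \<Longrightarrow> inv a \<otimes> b \<in> W"
    using nhds_of_continuous_map2[OF continuous_map_inv_mult W(1) one_closed one_closed] W(2) by auto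
  define W' where "W' = V1 \<inter> V2"
  have W': "openin T W'" "\<one> \<in> W'" "\<And>a b. a \<in> W' \<Longrightarrow> b \<in> W' \<Longrightarrow> inv a \<otimes> b \<in> W"
    unfolding W'_def using V12 by auto
  have W'c: "W' \<subseteq> carrier G"
    using openin_subset[OF W'(1)] topspace_eq by simp
  obtain D where D: "countable D" "D \<subseteq> carrier G" "Abstract_Topology.closure_of T D = carrier G"
    using separable unfolding separable_space_def topspace_eq by blast
  let ?Y = "(\<lambda>g. \<phi> g y) ` W'"
  have Y: "?Y \<subseteq> topspace X"
    using W'c yX act_closed by blast
  have "\<O> \<subseteq> (\<Union>q\<in>D. \<phi> q ` ?Y)"
  proof
    fix z assume "z \<in> \<O>"
    then obtain g where g: "g \<in> carrier G" "z = \<phi> g y"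
      using orbit_transitive[OF O(1,3)] by blast
    let ?N = "{q \<in> carrier G. inv q \<otimes> g \<in> W'}"
    have N_open: "openin T ?N"
      using W'(1) g continuous_map_id[unfolded id_def]
      by (intro openin_group_preimage continuous_map_group_mult continuous_map_group_inv)
        (auto simp: topspace_eq)
    have g_N: "g \<in> ?N"
      using g W'(2) by simp
    have "g \<in> Abstract_Topology.closure_of T D"
      using D(3) g(1) by simp
    then obtain q where "q \<in> D" "q \<in> ?N"
      using N_open g_N by (rule closure_of_meets)
    then have q: "q \<in> D" "q \<in> carrier G" "inv q \<otimes> g \<in> W'"
      by simp_all
    have "q \<otimes> (inv q \<otimes> g) = g"
      using q(2) g(1) by (simp flip: m_assoc)
    then have "z = \<phi> q (\<phi> (inv q \<otimes> g) y)"
      using q(2) g yX by (simp add: act_act)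
    then show "z \<in> (\<Union>q\<in>D. \<phi> q ` ?Y)"
      using q by blast
  qed
  then have not_meager: "\<not> meager_in X (\<Union>q\<in>D. \<phi> q ` ?Y)"
    using O(2) meager_in_subset by blast
  have "\<not> nowhere_dense_in X ?Y"
  proof
    assume "nowhere_dense_in X ?Y"
    then have "meager_in X (\<phi> q ` ?Y)" if "q \<in> D" for q
      using that D(2) by (intro meager_in_homeomorphic_image[OF homeomorphic_map_act]
          nowhere_dense_imp_meager_in) auto
    then show False
      using not_meager meager_in_UN[OF D(1), of X "\<lambda>q. \<phi> q ` ?Y"] by blast
  qed
  then obtain z where z: "z \<in> X interior_of (Abstract_Topology.closure_of X ?Y)"
    unfolding nowhere_dense_in_def using Y by blast
  then have "z \<in> Abstract_Topology.closure_of X ?Y"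
    using interior_of_subset by (rule subsetD[rotated])
  then obtain u where "u \<in> ?Y" "u \<in> X interior_of (Abstract_Topology.closure_of X ?Y)"
    using openin_interior_of z by (rule closure_of_meets)
  then obtain w where w: "w \<in> W'" "\<phi> w y \<in> X interior_of (Abstract_Topology.closure_of X ?Y)"
    by blast
  have wc: "w \<in> carrier G"
    using w(1) W'c by blast
  have h: "homeomorphic_map X X (\<phi> (inv w))"
    using homeomorphic_map_act wc by simp
  have "\<phi> (inv w) (\<phi> w y) = y"
    using wc yX by (simp add: act_act act_one)
  then have "y \<in> \<phi> (inv w) ` (X interior_of (Abstract_Topology.closure_of X ?Y))"
    using w(2) by (metis imageI)
  also have "\<dots> = X interior_of (Abstract_Topology.closure_of X (\<phi> (inv w) ` ?Y))"
    by (simp only: homeomorphic_map_closure_of[OF h Y]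
        homeomorphic_map_interior_of[OF h closure_of_subset_topspace])
  also have "\<dots> \<subseteq> X interior_of (Abstract_Topology.closure_of X ((\<lambda>g. \<phi> g y) ` W))"
  proof (intro interior_of_mono closure_of_mono image_subsetI)
    fix u assume "u \<in> ?Y"
    then obtain v where v: "v \<in> W'" "u = \<phi> v y"
      by blast
    then have "\<phi> (inv w) u = \<phi> (inv w \<otimes> v) y"
      using wc W'c yX by (simp add: act_act subset_iff)
    then show "\<phi> (inv w) u \<in> (\<lambda>g. \<phi> g y) ` W"
      using W'(3)[OF w(1) v(1)] by blast
  qed
  finally show ?thesis .
qed

text \<open>A back-and-forth argument turns the nearly open orbit maps into open ones. Let \<open>y\<close> in the
  orbit be close to \<open>x\<close>. Small group elements are applied in turn to \<open>x\<close> and to \<open>y\<close>, each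
  time bringing the two points closer and into a position, given by near openness, from
  which the next step is possible. By completeness of the group the accumulated elements
  converge to some \<open>pl\<close> and \<open>ql\<close> near \<open>\<one>\<close>; both points have the same limit, so
  \<open>\<phi> pl x = \<phi> ql y\<close> and \<open>inv ql \<otimes> pl\<close> maps \<open>x\<close> to \<open>y\<close>.\<close>

theorem Effros_open_orbit_map:
  assumes X: "metrizable_space X"
    and O: "\<O> \<in> orbits G (topspace X) \<phi>" "\<not> meager_in X \<O>" "x \<in> \<O>"
    and V: "openin T V" "\<one> \<in> V"
  obtains U where "openin X U" "x \<in> U" "\<O> \<inter> U \<subseteq> (\<lambda>g. \<phi> g x) ` V"
proof -
  note O_sub = orbit_subset[OF O(1)] and O_closed = orbit_closed[OF O(1)]
  obtain d where "Metric_space (carrier G) d" and compl: "Metric_space.mcomplete (carrier G) d"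
    and T: "T = Metric_space.mtopology (carrier G) d"
    by (rule complete_metric)
  interpret d: Metric_space "carrier G" d by fact
  obtain Mx \<rho> where Mx: "Metric_space Mx \<rho>" and X_eq: "X = Metric_space.mtopology Mx \<rho>"
    using X unfolding metrizable_space_def by blast
  interpret \<rho>: Metric_space Mx \<rho> by fact
  have topX: "topspace X = Mx"
    unfolding X_eq by simp
  obtain V1 V2 where V12: "openin T V1" "\<one> \<in> V1" "openin T V2" "\<one> \<in> V2"
    "\<And>a b. a \<in> V1 \<Longrightarrow> b \<in> V2 \<Longrightarrow> inv a \<otimes> b \<in> V"
    using nhds_of_continuous_map2[OF continuous_map_inv_mult V(1) one_closed one_closed] V(2) by auto
  have "openin d.mtopology (V1 \<inter> V2)" "\<one> \<in> V1 \<inter> V2"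
    using V12 T by auto
  then obtain \<delta> where \<delta>: "\<delta> > 0" "d.mcball \<one> \<delta> \<subseteq> V1 \<inter> V2"
    unfolding d.openin_mtopology_mcball by blast
  define r where "r n = \<delta> / 2 ^ n" for n :: nat
  have r_pos: "r n > 0" for n
    unfolding r_def using \<delta>(1) by simp
  \<comment> \<open>The multipliers allowed at stage \<open>n\<close> when \<open>p\<close> has been accumulated.  They depend on \<open>p\<close> because the
      metric need not be right invariant.\<close>
  define nb where "nb n p = {v \<in> carrier G. v \<otimes> p \<in> d.mball p (r n / 2)}" for n p
  have nb: "openin T (nb n p)" "\<one> \<in> nb n p" if "p \<in> carrier G" for n p
  proof -
    have "openin T (d.mball p (r n / 2))"
      using d.openin_mball T by metis
    then show "openin T (nb n p)"
      unfolding nb_def using that by (intro openin_group_preimage) simp_all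
    show "\<one> \<in> nb n p"
      unfolding nb_def using that r_pos[of n] by simp
  qed
  have nb_d: "v \<in> carrier G" "d p (v \<otimes> p) \<le> r n / 2" if "v \<in> nb n p" for v n p
    using that unfolding nb_def by auto
  \<comment> \<open>The points that can be approximated by moving \<open>y\<close> with multipliers allowed at stage \<open>n\<close>, in a
      stable way.\<close>
  define I where "I n p y = X interior_of (Abstract_Topology.closure_of X ((\<lambda>g. \<phi> g y) ` nb n p))" for n p y
  have I_open: "openin X (I n p y)" for n p y
    unfolding I_def by simp
  have I_self: "y \<in> I n p y" if "y \<in> \<O>" "p \<in> carrier G" for n p y
    unfolding I_def using orbit_map_nearly_open[OF O(1,2)] nb that by blast
  have I_meets: "\<exists>v\<in>nb n p. \<phi> v y \<in> W" if "z \<in> I n p y" "openin X W" "z \<in> W" for n p y z W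
  proof -
    have "z \<in> Abstract_Topology.closure_of X ((\<lambda>g. \<phi> g y) ` nb n p)"
      using that(1) unfolding I_def by (rule subsetD[OF interior_of_subset])
    then show ?thesis
      using closure_of_meets[OF _ that(2,3)] by blast
  qed
  have xX: "x \<in> topspace X"
    using O(3) O_sub by blast
  show ?thesis
  proof (rule that[of "I 0 \<one> x"])
    show "\<O> \<inter> I 0 \<one> x \<subseteq> (\<lambda>g. \<phi> g x) ` V"
    proof
      fix y assume "y \<in> \<O> \<inter> I 0 \<one> x"
      then have y: "y \<in> \<O>" "y \<in> I 0 \<one> x" "y \<in> topspace X"
        using O_sub by auto
      \<comment> \<open>A stage is the pair of the elements accumulated on the side of \<open>x\<close> and on the side of \<open>y\<close>; by
          \<open>?P\<close> it is the turn of \<open>x\<close> to be moved towards \<open>y\<close>.\<close>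
      let ?P = "\<lambda>n z. fst z \<in> carrier G \<and> snd z \<in> carrier G \<and> \<phi> (snd z) y \<in> I n (fst z) (\<phi> (fst z) x)
        \<and> (n = 0 \<longrightarrow> z = (\<one>, \<one>))"
      let ?Q = "\<lambda>n z z'. d (fst z) (fst z') \<le> r n / 2 \<and> d (snd z) (snd z') \<le> r n / 2
        \<and> \<rho> (\<phi> (fst z') x) (\<phi> (snd z) y) < (1/2) ^ n"
      have "\<exists>s. \<forall>n. ?P n (s n) \<and> ?Q n (s n) (s (Suc n))"
      proof (rule dependent_nat_choice)
        show "\<exists>z. ?P 0 z"
          using y xX by (intro exI[of _ "(\<one>, \<one>)"]) (simp add: act_one)
      next
        fix z and n :: nat
        assume z: "?P n z"
        obtain p q where pq: "z = (p, q)" by fastforce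
        have p: "p \<in> carrier G" "\<phi> p x \<in> \<O>" and q: "q \<in> carrier G" "\<phi> q y \<in> \<O>"
          and qI: "\<phi> q y \<in> I n p (\<phi> p x)"
          using z pq y(1) O(3) O_closed by auto
        have qX: "\<phi> q y \<in> Mx"
          using q(2) O_sub topX by blast
        let ?W = "I n q (\<phi> q y) \<inter> \<rho>.mball (\<phi> q y) ((1/2) ^ n)"
        have "openin X ?W"
          using I_open X_eq by auto
        moreover have "\<phi> q y \<in> ?W"
          using I_self[OF q(2,1)] qX by simp
        ultimately obtain v where v: "v \<in> nb n p" "\<phi> v (\<phi> p x) \<in> ?W"
          using I_meets[OF qI] by blast
        have vc: "v \<in> carrier G"
          using nb_d(1)[OF v(1)] .
        have x': "\<phi> (v \<otimes> p) x = \<phi> v (\<phi> p x)"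
          using xX p(1) vc by (simp add: act_act)
        have "\<phi> (v \<otimes> p) x \<in> I (Suc n) (v \<otimes> p) (\<phi> (v \<otimes> p) x)"
          using I_self O_closed O(3) vc p(1) by simp
        then obtain v' where v': "v' \<in> nb n q" "\<phi> v' (\<phi> q y) \<in> I (Suc n) (v \<otimes> p) (\<phi> (v \<otimes> p) x)"
          using I_meets[of "\<phi> (v \<otimes> p) x" n q "\<phi> q y"] v(2) I_open x' by (metis IntD1)
        have v'c: "v' \<in> carrier G"
          using nb_d(1)[OF v'(1)] .
        have y': "\<phi> (v' \<otimes> q) y = \<phi> v' (\<phi> q y)"
          using y(3) q(1) v'c by (simp add: act_act)
        have "\<rho> (\<phi> (v \<otimes> p) x) (\<phi> q y) < (1/2) ^ n"
          using v(2) x' \<rho>.commute by simp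
        then show "\<exists>z'. ?P (Suc n) z' \<and> ?Q n z z'"
          using pq p(1) q(1) vc v'c v' y' nb_d(2)[OF v(1)] nb_d(2)[OF v'(1)]
          by (intro exI[of _ "(v \<otimes> p, v' \<otimes> q)"]) simp
      qed
      then obtain s where s: "\<And>n. ?P n (s n) \<and> ?Q n (s n) (s (Suc n))"
        by blast
      define p q where "p n = fst (s n)" and "q n = snd (s n)" for n
      have pc: "p n \<in> carrier G" "q n \<in> carrier G" and
        st: "d (p n) (p (Suc n)) \<le> r n / 2" "d (q n) (q (Suc n)) \<le> r n / 2" and
        close: "\<rho> (\<phi> (p (Suc n)) x) (\<phi> (q n) y) < (1/2) ^ n" for n
        using s[of n] unfolding p_def q_def by blast+
      have 0: "p 0 = \<one>" "q 0 = \<one>"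
        using s[of 0] unfolding p_def q_def by auto
      have half: "r (Suc n) \<le> r n / 2" for n
        unfolding r_def by simp
      obtain pl where pl: "limitin d.mtopology p pl sequentially" "\<And>n. d (p n) pl \<le> r n"
        using d.halving_steps_converge[OF compl, of p r] pc(1) r_pos half st(1) by (metis less_imp_le)
      obtain ql where ql: "limitin d.mtopology q ql sequentially" "\<And>n. d (q n) ql \<le> r n"
        using d.halving_steps_converge[OF compl, of q r] pc(2) r_pos half st(2) by (metis less_imp_le)
      have lc: "pl \<in> carrier G" "ql \<in> carrier G"
        using pl(1) ql(1) d.limitin_mspace by blast+
      have "pl \<in> V1" "ql \<in> V2" "ql \<in> V1" "pl \<in> V2"
        using \<delta>(2) lc pl(2)[of 0] ql(2)[of 0] unfolding 0 r_def by auto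
      have limx: "limitin \<rho>.mtopology (\<lambda>n. \<phi> (p n) x) (\<phi> pl x) sequentially"
        using continuous_map_limit[OF continuous_map_orbit_map[OF xX] pl(1)[folded T]] unfolding X_eq o_def .
      have limy: "limitin \<rho>.mtopology (\<lambda>n. \<phi> (q n) y) (\<phi> ql y) sequentially"
        using continuous_map_limit[OF continuous_map_orbit_map[OF y(3)] ql(1)[folded T]] unfolding X_eq o_def .
      have "(\<lambda>n. \<rho> (\<phi> (p n) x) (\<phi> pl x)) \<longlonglongrightarrow> 0" "(\<lambda>n. \<rho> (\<phi> (q n) y) (\<phi> ql y)) \<longlonglongrightarrow> 0"
        using limx limy unfolding \<rho>.limitin_metric_dist_null by auto
      then have "(\<lambda>n. \<rho> (\<phi> (p (Suc n)) x) (\<phi> pl x) + (1/2) ^ n + \<rho> (\<phi> (q n) y) (\<phi> ql y)) \<longlonglongrightarrow> 0 + 0 + 0"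
        by (intro tendsto_add LIMSEQ_power_zero LIMSEQ_Suc) auto
      moreover have "\<rho> (\<phi> pl x) (\<phi> ql y) \<le>
        \<rho> (\<phi> (p (Suc n)) x) (\<phi> pl x) + (1/2) ^ n + \<rho> (\<phi> (q n) y) (\<phi> ql y)" for n
      proof -
        have m: "\<phi> pl x \<in> Mx" "\<phi> ql y \<in> Mx" "\<phi> (p (Suc n)) x \<in> Mx" "\<phi> (q n) y \<in> Mx"
          using act_closed lc pc xX y(3) topX by auto
        show ?thesis
          using \<rho>.triangle[OF m(1,3,2)] \<rho>.triangle[OF m(3,4,2)] close[of n]
            \<rho>.commute[of "\<phi> pl x" "\<phi> (p (Suc n)) x"] by linarith
      qed
      ultimately have "\<rho> (\<phi> pl x) (\<phi> ql y) \<le> 0"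
        using LIMSEQ_le_const by fastforce
      then have "\<phi> pl x = \<phi> ql y"
        using \<rho>.zero[of "\<phi> pl x" "\<phi> ql y"] \<rho>.nonneg[of "\<phi> pl x" "\<phi> ql y"] act_closed lc xX y(3) topX by auto
      then have "y = \<phi> (inv ql) (\<phi> pl x)"
        using lc y(3) by (simp add: act_act act_one)
      also have "\<dots> = \<phi> (inv ql \<otimes> pl) x"
        using lc xX by (simp add: act_act)
      finally show "y \<in> (\<lambda>g. \<phi> g x) ` V"
        using V12(5)[OF \<open>ql \<in> V1\<close> \<open>pl \<in> V2\<close>] by blast
    qed
  qed (use I_open I_self O(3) in auto)
qed

end

section \<open>Generic tuples\<close>

context topological_group
begin

abbreviation power_topology :: "nat \<Rightarrow> (nat \<Rightarrow> 'a) topology" where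
  "power_topology n \<equiv> product_topology (\<lambda>_. T) {..<n}"

lemma topspace_power_topology: "topspace (power_topology n) = tuples G n"
  by (simp add: topspace_eq)

lemma tuples_append:
  assumes "x \<in> tuples G n" and "y \<in> carrier G"
  shows "x(n := y) \<in> tuples G (Suc n)"
  using assms by (auto simp: PiE_iff extensional_def less_Suc_eq)

lemma diag_conj_apply:
  assumes "x \<in> tuples G n" and "i < n"
  shows "diag_conj G n g x i = g \<otimes> x i \<otimes> inv g"
  using assms by (simp add: diag_conj_def)

lemma diag_conj_append:
  assumes g: "g \<in> carrier G" and x: "x \<in> tuples G n" and y: "y \<in> carrier G"
  shows "diag_conj G (Suc n) g (x(n := y)) = (diag_conj G n g x)(n := g \<otimes> y \<otimes> inv g)"
proof
  fix i
  show "diag_conj G (Suc n) g (x(n := y)) i = ((diag_conj G n g x)(n := g \<otimes> y \<otimes> inv g)) i"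
    using tuples_append[OF x y] x by (simp add: diag_conj_def less_Suc_eq)
qed

text \<open>Tuples of length \<open>n + 1\<close> are identified with pairs of a tuple of length \<open>n\<close> and a last
  entry, so that the Kuratowski-Ulam theorem applies to them.\<close>

lemma homeomorphic_map_append:
  "homeomorphic_map (prod_topology (power_topology n) T) (power_topology (Suc n)) (\<lambda>(x, y). x(n := y))"
proof -
  let ?P = "prod_topology (power_topology n) T"
  have "continuous_map ?P (power_topology (Suc n)) (\<lambda>(x, y). x(n := y))"
    unfolding continuous_map_componentwise
  proof (intro conjI ballI)
    show "(\<lambda>(x, y). x(n := y)) ` topspace ?P \<subseteq> extensional {..<Suc n}"
      by (auto simp: topspace_eq PiE_iff extensional_def)
    fix k assume "k \<in> {..<Suc n}"
    then consider "k = n" | "k < n" by fastforce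
    then show "continuous_map ?P T (\<lambda>z. (case z of (x, y) \<Rightarrow> x(n := y)) k)"
    proof cases
      case 1
      then show ?thesis
        by (simp add: case_prod_beta continuous_map_snd)
    next
      case 2
      then have "continuous_map (power_topology n) T (\<lambda>x. x k)"
        by (intro continuous_map_product_projection) simp
      then have "continuous_map ?P T ((\<lambda>x. x k) \<circ> fst)"
        by (rule continuous_map_compose[OF continuous_map_fst])
      then show ?thesis
        using 2 by (simp add: case_prod_beta o_def)
    qed
  qed
  moreover have "continuous_map (power_topology (Suc n)) ?P (\<lambda>x. (restrict x {..<n}, x n))"
    unfolding continuous_map_paired
  proof
    show "continuous_map (power_topology (Suc n)) (power_topology n) (\<lambda>x. restrict x {..<n})"
      unfolding continuous_map_componentwise
    proof (intro conjI ballI)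
      fix k assume k: "k \<in> {..<n}"
      then have "continuous_map (power_topology (Suc n)) T (\<lambda>x. x k)"
        by (intro continuous_map_product_projection) simp
      then show "continuous_map (power_topology (Suc n)) T (\<lambda>x. restrict x {..<n} k)"
        using k by simp
    qed auto
    show "continuous_map (power_topology (Suc n)) T (\<lambda>x. x n)"
      by (intro continuous_map_product_projection) simp
  qed
  ultimately have "homeomorphic_maps ?P (power_topology (Suc n))
      (\<lambda>(x, y). x(n := y)) (\<lambda>x. (restrict x {..<n}, x n))"
    unfolding homeomorphic_maps_def
    by (auto simp: topspace_eq PiE_iff extensional_def less_Suc_eq fun_eq_iff)
  then show ?thesis
    using homeomorphic_map_maps by blast
qed

end

context polish_group
begin

lemma second_countable: "second_countable T"
  using completely_metrizable separable
  by (intro separable_metrizable_imp_second_countable completely_metrizable_imp_metrizable_space)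

lemma completely_metrizable_power_topology: "completely_metrizable_space (power_topology n)"
  unfolding completely_metrizable_space_product_topology
  using completely_metrizable by (intro disjI2 conjI ballI countable_finite) simp_all

lemma polish_action_diag_conj: "polish_action G T (power_topology n) (diag_conj G n)"
proof (intro polish_action.intro polish_action_axioms.intro)
  show "polish_group G T" ..
  show "group_action G (topspace (power_topology n)) (diag_conj G n)"
    unfolding topspace_power_topology by (rule diag_conj_action)
  let ?P = "prod_topology T (power_topology n)"
  show "continuous_map ?P (power_topology n) (\<lambda>(g, x). diag_conj G n g x)"
    unfolding continuous_map_componentwise
  proof (intro conjI ballI)
    show "(\<lambda>(g, x). diag_conj G n g x) ` topspace ?P \<subseteq> extensional {..<n}"
    proof clarify
      fix g x assume "(g, x) \<in> topspace ?P"
      then have "x \<in> tuples G n"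
        by (simp add: topspace_eq)
      then show "diag_conj G n g x \<in> extensional {..<n}"
        by (simp add: diag_conj_def)
    qed
    fix k assume k: "k \<in> {..<n}"
    then have "continuous_map (power_topology n) T (\<lambda>x. x k)"
      by (intro continuous_map_product_projection) simp
    then have "continuous_map ?P T ((\<lambda>x. x k) \<circ> snd)"
      by (rule continuous_map_compose[OF continuous_map_snd])
    then have "continuous_map ?P T (\<lambda>z. snd z k)"
      by (simp only: o_def)
    then have "continuous_map ?P T (\<lambda>z. fst z \<otimes> snd z k \<otimes> inv (fst z))"
      by (intro continuous_map_group_mult continuous_map_group_inv continuous_map_fst)
    then show "continuous_map ?P T (\<lambda>z. (case z of (g, x) \<Rightarrow> diag_conj G n g x) k)"
    proof (rule continuous_map_eq)
      fix z assume "z \<in> topspace ?P"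
      then have "snd z \<in> tuples G n"
        by (simp add: topspace_eq mem_Times_iff)
      then show "fst z \<otimes> snd z k \<otimes> inv (fst z) = (case z of (g, x) \<Rightarrow> diag_conj G n g x) k"
        using diag_conj_apply[of "snd z" n k "fst z"] k by (simp add: case_prod_beta)
    qed
  qed
qed

lemma comeager_in_power_topology_not_meager:
  assumes "comeager_in (power_topology n) \<O>"
  shows "\<not> meager_in (power_topology n) \<O>"
proof
  assume "meager_in (power_topology n) \<O>"
  then have "meager_in (power_topology n) (\<O> \<union> (topspace (power_topology n) - \<O>))"
    using assms unfolding comeager_in_def by (intro meager_in_Un) auto
  then have "meager_in (power_topology n) (topspace (power_topology n))"
    by (rule meager_in_subset) blast
  moreover have "(\<lambda>i\<in>{..<n}. \<one>) \<in> topspace (power_topology n)"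
    by (simp add: topspace_eq)
  ultimately show False
    using openin_not_meager_in[OF completely_metrizable_power_topology openin_topspace] by blast
qed

text \<open>By the Kuratowski-Ulam theorem the claim holds for comeagerly many tuples, hence for some
  \<open>w\<close> in the comeager orbit \<open>\<O>\<close>. The section at \<open>g w\<close> is the conjugate by \<open>g\<close> of the section
  at \<open>w\<close>, because \<open>\<O>'\<close> is invariant; so the claim spreads to the whole orbit.\<close>

lemma comeager_orbit_section:
  assumes O: "\<O> \<in> orbits G (tuples G n) (diag_conj G n)" "comeager_in (power_topology n) \<O>"
    and O': "\<O>' \<in> orbits G (tuples G (Suc n)) (diag_conj G (Suc n))"
      "comeager_in (power_topology (Suc n)) \<O>'"
    and x: "x \<in> \<O>"
  shows "comeager_in T {y \<in> carrier G. x(n := y) \<in> \<O>'}"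
proof -
  interpret act: polish_action G T "power_topology n" "diag_conj G n"
    by (rule polish_action_diag_conj)
  interpret act': polish_action G T "power_topology (Suc n)" "diag_conj G (Suc n)"
    by (rule polish_action_diag_conj)
  have O_orb: "\<O> \<in> orbits G (topspace (power_topology n)) (diag_conj G n)"
    and O'_orb: "\<O>' \<in> orbits G (topspace (power_topology (Suc n))) (diag_conj G (Suc n))"
    using O(1) O'(1) unfolding topspace_power_topology .
  have O_sub: "\<O> \<subseteq> tuples G n"
    using act.orbit_subset[OF O_orb] unfolding topspace_power_topology .
  let ?P = "prod_topology (power_topology n) T"
  define E where "E = {z \<in> topspace ?P. (\<lambda>(x, y). x(n := y)) z \<notin> \<O>'}"
  have "meager_in ?P E"
  proof -
    obtain g where g: "homeomorphic_maps ?P (power_topology (Suc n)) (\<lambda>(x, y). x(n := y)) g"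
      using homeomorphic_map_append homeomorphic_map_maps by blast
    have "homeomorphic_map (power_topology (Suc n)) ?P g"
      using g homeomorphic_maps_map by blast
    then have "meager_in ?P (g ` (topspace (power_topology (Suc n)) - \<O>'))"
      using O'(2) unfolding comeager_in_def by (intro meager_in_homeomorphic_image) auto
    moreover have "E \<subseteq> g ` (topspace (power_topology (Suc n)) - \<O>')"
    proof
      fix z assume z: "z \<in> E"
      then have "z \<in> topspace ?P" and notO: "(\<lambda>(x, y). x(n := y)) z \<notin> \<O>'"
        unfolding E_def by blast+
      then have "g ((\<lambda>(x, y). x(n := y)) z) = z"
        "(\<lambda>(x, y). x(n := y)) z \<in> topspace (power_topology (Suc n))"
        using g homeomorphic_imp_surjective_map[OF homeomorphic_map_append[of n]]
        unfolding homeomorphic_maps_def by blast+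
      then show "z \<in> g ` (topspace (power_topology (Suc n)) - \<O>')"
        using notO by (intro image_eqI[of z g "(\<lambda>(x, y). x(n := y)) z"]) simp_all
    qed
    ultimately show ?thesis
      by (rule meager_in_subset)
  qed
  then have "meager_in (power_topology n)
      {x \<in> topspace (power_topology n). \<not> meager_in T {y. (x, y) \<in> E}}"
    by (rule Kuratowski_Ulam_meager[OF second_countable])
  then have "\<not> \<O> \<subseteq> {x \<in> topspace (power_topology n). \<not> meager_in T {y. (x, y) \<in> E}}"
    using comeager_in_power_topology_not_meager[OF O(2)] meager_in_subset by blast
  then obtain w where w: "w \<in> \<O>" "meager_in T {y. (w, y) \<in> E}"
    using O_sub unfolding topspace_power_topology by blast
  obtain g where g: "g \<in> carrier G" "x = diag_conj G n g w"
    using act.orbit_transitive[OF O_orb w(1) x] by blast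
  have "carrier G - {y \<in> carrier G. x(n := y) \<in> \<O>'} \<subseteq> (\<lambda>y. g \<otimes> y \<otimes> inv g) ` {y. (w, y) \<in> E}"
  proof
    fix y assume y: "y \<in> carrier G - {y \<in> carrier G. x(n := y) \<in> \<O>'}"
    define z where "z = inv g \<otimes> y \<otimes> g"
    have z: "z \<in> carrier G" "g \<otimes> z \<otimes> inv g = y"
      using y g(1) unfolding z_def by (auto simp: m_assoc) (simp flip: m_assoc)
    have "w(n := z) \<notin> \<O>'"
    proof
      assume "w(n := z) \<in> \<O>'"
      then have "diag_conj G (Suc n) g (w(n := z)) \<in> \<O>'"
        by (rule act'.orbit_closed[OF O'_orb g(1)])
      then show False
        using y g(2) z diag_conj_append[OF g(1) _ z(1), of w n] w(1) O_sub by auto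
    qed
    then have "(w, z) \<in> E"
      using w(1) O_sub z(1) unfolding E_def by (auto simp: topspace_eq)
    then show "y \<in> (\<lambda>y. g \<otimes> y \<otimes> inv g) ` {y. (w, y) \<in> E}"
      using z(2) by force
  qed
  moreover have "meager_in T ((\<lambda>y. g \<otimes> y \<otimes> inv g) ` {y. (w, y) \<in> E})"
    using meager_in_homeomorphic_image[OF homeomorphic_map_two_sided_mult w(2)] g(1) by simp
  ultimately show ?thesis
    unfolding comeager_in_def topspace_eq using meager_in_subset by blast
qed

text \<open>Effros' theorem is applied to the action of \<open>G\<close> on tuples of length \<open>n + 1\<close>, not to that of
  the stabilizer of \<open>x\<close> on \<open>G\<close>: an element that maps \<open>x(n := y)\<close> to \<open>x(n := z)\<close> fixes \<open>x\<close>
  anyway.\<close>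

lemma generic_tuple_extension:
  assumes O: "\<O> \<in> orbits G (tuples G n) (diag_conj G n)" "comeager_in (power_topology n) \<O>"
    and O': "\<O>' \<in> orbits G (tuples G (Suc n)) (diag_conj G (Suc n))"
      "comeager_in (power_topology (Suc n)) \<O>'"
    and x: "x \<in> \<O>"
    and A: "A \<subseteq> carrier G" "\<not> meager_in T A"
    and B: "B \<subseteq> carrier G" "\<And>U. openin T U \<Longrightarrow> U \<noteq> {} \<Longrightarrow> \<not> meager_in T (U \<inter> B)"
    and V: "openin T V" "\<one> \<in> V"
  obtains y z v where "y \<in> A" "z \<in> B" "v \<in> V" "x(n := y) \<in> \<O>'" "x(n := z) \<in> \<O>'"
    "\<And>i. i < n \<Longrightarrow> v \<otimes> x i \<otimes> inv v = x i" "v \<otimes> y \<otimes> inv v = z"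
proof -
  interpret act: polish_action G T "power_topology n" "diag_conj G n"
    by (rule polish_action_diag_conj)
  interpret act': polish_action G T "power_topology (Suc n)" "diag_conj G (Suc n)"
    by (rule polish_action_diag_conj)
  have O_orb: "\<O> \<in> orbits G (topspace (power_topology n)) (diag_conj G n)"
    and O'_orb: "\<O>' \<in> orbits G (topspace (power_topology (Suc n))) (diag_conj G (Suc n))"
    using O(1) O'(1) unfolding topspace_power_topology .
  have x_tup: "x \<in> tuples G n"
    using subsetD[OF act.orbit_subset[OF O_orb] x] unfolding topspace_power_topology .
  note sect = comeager_orbit_section[OF O O' x]
  have "A \<inter> {y \<in> carrier G. x(n := y) \<in> \<O>'} \<noteq> {}"
    using comeager_in_Int_not_meager[OF sect A(2)] A(1) topspace_eq by simp
  then obtain y where y: "y \<in> A" "y \<in> carrier G" "x(n := y) \<in> \<O>'"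
    by blast
  have "metrizable_space (power_topology (Suc n))"
    using completely_metrizable_power_topology completely_metrizable_imp_metrizable_space by blast
  then obtain U where U: "openin (power_topology (Suc n)) U" "x(n := y) \<in> U"
    "\<O>' \<inter> U \<subseteq> (\<lambda>g. diag_conj G (Suc n) g (x(n := y))) ` V"
    by (rule act'.Effros_open_orbit_map[OF _ O'_orb comeager_in_power_topology_not_meager[OF O'(2)] y(3) V])
  \<comment> \<open>The slice of \<open>U\<close> at \<open>x\<close>; it is open and contains \<open>y\<close>, so \<open>B\<close> is not meager in it.\<close>
  define W where "W = {z \<in> carrier G. x(n := z) \<in> U}"
  have "continuous_map T (prod_topology (power_topology n) T) (\<lambda>z. (x, z))"
    using x_tup by (simp add: continuous_map_paired topspace_eq)
  then have "continuous_map T (power_topology (Suc n)) ((\<lambda>(x, y). x(n := y)) \<circ> (\<lambda>z. (x, z)))"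
    by (rule continuous_map_compose[OF _ homeomorphic_imp_continuous_map[OF homeomorphic_map_append]])
  then have "continuous_map T (power_topology (Suc n)) (\<lambda>z. x(n := z))"
    by (simp add: o_def)
  then have "openin T W"
    unfolding W_def topspace_eq[symmetric] using U(1) by (rule openin_continuous_map_preimage)
  moreover have "W \<noteq> {}"
    using y(2) U(2) unfolding W_def by blast
  ultimately have "\<not> meager_in T (W \<inter> B)"
    by (rule B(2))
  moreover have "W \<inter> B \<subseteq> topspace T"
    using B(1) topspace_eq by blast
  ultimately have "W \<inter> B \<inter> {y \<in> carrier G. x(n := y) \<in> \<O>'} \<noteq> {}"
    by (rule comeager_in_Int_not_meager[OF sect])
  then obtain z where z: "z \<in> B" "z \<in> carrier G" "x(n := z) \<in> U" "x(n := z) \<in> \<O>'"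
    unfolding W_def by blast
  then obtain v where v: "v \<in> V" "x(n := z) = diag_conj G (Suc n) v (x(n := y))"
    using U(3) by blast
  have vc: "v \<in> carrier G"
    using v(1) openin_subset[OF V(1)] topspace_eq by blast
  have eq: "x(n := z) = (diag_conj G n v x)(n := v \<otimes> y \<otimes> inv v)"
    using v(2) diag_conj_append[OF vc x_tup y(2)] by simp
  show ?thesis
  proof (rule that[OF y(1) z(1) v(1) y(3) z(4)])
    show "v \<otimes> y \<otimes> inv v = z"
      using fun_cong[OF eq, of n] by simp
    show "v \<otimes> x i \<otimes> inv v = x i" if "i < n" for i
      using fun_cong[OF eq, of i] that diag_conj_apply[OF x_tup that, of v] by simp
  qed
qed

end

section \<open>A tree of conjugates\<close>

text \<open>With \<open>c' = c\<close>, what \<open>p\<close> does to \<open>c\<close> is unchanged when \<open>p\<close> is multiplied by an element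
  commuting with \<open>c\<close>; with \<open>c'\<close> different from \<open>c\<close>, it is the coincidence created at a
  branching node.\<close>

lemma (in group) inv_conj_eq:
  assumes "v \<in> carrier G" "p \<in> carrier G" "c \<in> carrier G" and "v \<otimes> c \<otimes> inv v = c'"
  shows "inv (v \<otimes> p) \<otimes> c' \<otimes> (v \<otimes> p) = inv p \<otimes> c \<otimes> p"
proof -
  have cancel: "inv v \<otimes> (v \<otimes> w) = w" if "w \<in> carrier G" for w
    using assms(1) that by (simp flip: m_assoc)
  show ?thesis
    unfolding assms(4)[symmetric] using assms(1-3) by (simp add: inv_mult_group m_assoc cancel)
qed

context polish_group
begin

text \<open>The tuple \<open>x a n\<close> and the element \<open>p a n\<close> at height \<open>n\<close> on the branch \<open>a\<close> depend only on
  \<open>a \<inter> {..<n}\<close>. At a node with tuple \<open>x\<close> and element \<open>h\<close> the branches not containing \<open>n\<close>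
  append \<open>y \<in> A\<close> and keep \<open>h\<close>, the others append \<open>z = v \<otimes> y \<otimes> inv v \<in> B\<close> and pass to
  \<open>v \<otimes> h\<close>. On both sides conjugating the new entry back gives \<open>inv h \<otimes> y \<otimes> h\<close>, and this
  value survives all later steps, as later multipliers commute with the entry, and the
  passage to the limit.\<close>

lemma generic_tree:
  assumes ample: "ample_generics G T"
    and A: "A \<subseteq> carrier G" "\<not> meager_in T A"
    and B: "B \<subseteq> carrier G" "\<And>U. openin T U \<Longrightarrow> U \<noteq> {} \<Longrightarrow> \<not> meager_in T (U \<inter> B)"
  obtains p :: "nat set \<Rightarrow> 'a" where "\<And>a. p a \<in> carrier G"
    "\<And>a b n. n \<notin> a \<Longrightarrow> n \<in> b \<Longrightarrow> (\<And>i. i < n \<Longrightarrow> i \<in> a \<longleftrightarrow> i \<in> b) \<Longrightarrow>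
      \<exists>y\<in>A. \<exists>z\<in>B. inv (p a) \<otimes> y \<otimes> p a = inv (p b) \<otimes> z \<otimes> p b"
proof -
  obtain d where "Metric_space (carrier G) d" and compl: "Metric_space.mcomplete (carrier G) d"
    and T: "T = Metric_space.mtopology (carrier G) d"
    by (rule complete_metric)
  interpret d: Metric_space "carrier G" d by fact
  \<comment> \<open>Ample generics provide orbits for \<open>n \<ge> 1\<close>; the tree starts at the empty tuple, the single
      point of \<open>G\<^sup>0\<close>.\<close>
  have "\<exists>\<O>. \<O> \<in> orbits G (tuples G n) (diag_conj G n) \<and> comeager_in (power_topology n) \<O>" for n
  proof (cases "n = 0")
    case True
    let ?\<O> = "orbit G (diag_conj G n) (\<lambda>_. undefined)"
    have tup: "tuples G n = {\<lambda>_. undefined}"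
      using True by simp
    have 1: "?\<O> \<in> orbits G (tuples G n) (diag_conj G n)"
      unfolding orbits_def tup by blast
    have 2: "?\<O> = tuples G n"
    proof
      show "?\<O> \<subseteq> tuples G n"
        using polish_action.orbit_subset[OF polish_action_diag_conj, of ?\<O> n] 1
        unfolding topspace_power_topology .
      have "diag_conj G n \<one> (\<lambda>_. undefined) \<in> ?\<O>"
        unfolding orbit_def by blast
      moreover have "diag_conj G n \<one> (\<lambda>_. undefined) = (\<lambda>_. undefined)"
        using polish_action.act_one[OF polish_action_diag_conj, of "\<lambda>_. undefined" n]
        unfolding topspace_power_topology tup by simp
      ultimately show "tuples G n \<subseteq> ?\<O>"
        unfolding tup by simp
    qed
    have "comeager_in (power_topology n) ?\<O>"
      unfolding comeager_in_def 2 topspace_power_topology by (auto simp: meager_in_def)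
    then show ?thesis
      using 1 by blast
  next
    case False
    then show ?thesis
      using ample unfolding ample_generics_def Bex_def by simp
  qed
  then obtain \<O> where O: "\<And>n. \<O> n \<in> orbits G (tuples G n) (diag_conj G n)"
    "\<And>n. comeager_in (power_topology n) (\<O> n)"
    by metis
  define good where "good n x h y z v \<longleftrightarrow> y \<in> A \<and> z \<in> B \<and> v \<in> carrier G \<and> d h (v \<otimes> h) \<le> (1/2) ^ n / 2
    \<and> x(n := y) \<in> \<O> (Suc n) \<and> x(n := z) \<in> \<O> (Suc n)
    \<and> (\<forall>i<n. v \<otimes> x i \<otimes> inv v = x i) \<and> v \<otimes> y \<otimes> inv v = z" for n x h y z v
  have good_ex: "\<exists>y z v. good n x h y z v" if x: "x \<in> \<O> n" and h: "h \<in> carrier G" for n x h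
  proof -
    define V where "V = {v \<in> carrier G. v \<otimes> h \<in> d.mball h ((1/2) ^ n / 2)}"
    have "openin T (d.mball h ((1/2) ^ n / 2))"
      using d.openin_mball T by metis
    then have V: "openin T V"
      unfolding V_def using h by (intro openin_group_preimage) simp_all
    have one: "\<one> \<in> V"
      unfolding V_def using h by simp
    show ?thesis
    proof (rule generic_tuple_extension[OF O O x A B V one])
      fix y z v assume "y \<in> A" "z \<in> B" "v \<in> V" "x(n := y) \<in> \<O> (Suc n)" "x(n := z) \<in> \<O> (Suc n)"
        "\<And>i. i < n \<Longrightarrow> v \<otimes> x i \<otimes> inv v = x i" "v \<otimes> y \<otimes> inv v = z"
      then have "good n x h y z v"
        unfolding good_def V_def by simp
      then show ?thesis
        by blast
    qed
  qed
  define e where "e n x h = (SOME (y, z, v). good n x h y z v)" for n x h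
  define ey ez ev where "ey n x h = fst (e n x h)" and "ez n x h = fst (snd (e n x h))"
    and "ev n x h = snd (snd (e n x h))" for n x h
  have e: "good n x h (ey n x h) (ez n x h) (ev n x h)" if "x \<in> \<O> n" and "h \<in> carrier G" for n x h
  proof -
    have "\<exists>t. (case t of (y, z, v) \<Rightarrow> good n x h y z v)"
      using good_ex[OF that] by simp
    then have "case e n x h of (y, z, v) \<Rightarrow> good n x h y z v"
      unfolding e_def by (rule someI_ex)
    then show ?thesis
      unfolding ey_def ez_def ev_def by (simp add: case_prod_beta)
  qed
  define st where "st a = rec_nat (\<one>, \<lambda>_. undefined) (\<lambda>n (h, x).
    if n \<in> a then (ev n x h \<otimes> h, x(n := ez n x h)) else (h, x(n := ey n x h)))" for a
  define p x where "p a n = fst (st a n)" and "x a n = snd (st a n)" for a n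
  have p0: "p a 0 = \<one>" and x0: "x a 0 = (\<lambda>_. undefined)" for a
    unfolding p_def x_def st_def by simp_all
  have pS: "p a (Suc n) = (if n \<in> a then ev n (x a n) (p a n) \<otimes> p a n else p a n)"
    and xS: "x a (Suc n) = (if n \<in> a then (x a n)(n := ez n (x a n) (p a n)) else (x a n)(n := ey n (x a n) (p a n)))"
    for a n
    unfolding p_def x_def st_def by (simp_all add: case_prod_beta)
  have O0: "(\<lambda>_. undefined) \<in> \<O> 0"
    using comeager_in_power_topology_not_meager[OF O(2)[of 0]]
      polish_action.orbit_subset[OF polish_action_diag_conj, of "\<O> 0" 0] O(1)[of 0]
    by (auto simp: topspace_power_topology meager_in_def)
  have tree: "p a n \<in> carrier G \<and> x a n \<in> \<O> n" for a n
  proof (induction n)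
    case 0
    then show ?case using O0 by (simp add: p0 x0)
  next
    case (Suc n)
    then have "good n (x a n) (p a n) (ey n (x a n) (p a n)) (ez n (x a n) (p a n)) (ev n (x a n) (p a n))"
      using e by blast
    then have "ev n (x a n) (p a n) \<in> carrier G" "(x a n)(n := ey n (x a n) (p a n)) \<in> \<O> (Suc n)"
      "(x a n)(n := ez n (x a n) (p a n)) \<in> \<O> (Suc n)"
      unfolding good_def by blast+
    then show ?case
      using Suc xS[of a n] pS[of a n] by (metis m_closed)
  qed
  have good: "good n (x a n) (p a n) (ey n (x a n) (p a n)) (ez n (x a n) (p a n)) (ev n (x a n) (p a n))"
    for a n
    using e tree by blast
  have x_in: "x a (Suc n) n \<in> carrier G" for a n
    using good[of n a] A(1) B(1) unfolding good_def by (auto simp: xS)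
  have x_stable: "x a m i = x a (Suc i) i" if "Suc i \<le> m" for a i m
    using that by (induction m rule: dec_induct) (simp_all add: xS)
  have conj_stable: "inv (p a m) \<otimes> x a (Suc i) i \<otimes> p a m
      = inv (p a (Suc i)) \<otimes> x a (Suc i) i \<otimes> p a (Suc i)" if "Suc i \<le> m" for a i m
    using that
  proof (induction m rule: dec_induct)
    case (step m)
    have "ev m (x a m) (p a m) \<otimes> x a m i \<otimes> inv (ev m (x a m) (p a m)) = x a m i"
      using good[of m a] step.hyps unfolding good_def by (simp add: Suc_le_eq)
    then have "ev m (x a m) (p a m) \<otimes> x a (Suc i) i \<otimes> inv (ev m (x a m) (p a m)) = x a (Suc i) i"
      unfolding x_stable[OF step.hyps(1)] .
    moreover have "ev m (x a m) (p a m) \<in> carrier G"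
      using good[of m a] unfolding good_def by blast
    ultimately have "inv (p a (Suc m)) \<otimes> x a (Suc i) i \<otimes> p a (Suc m)
        = inv (p a m) \<otimes> x a (Suc i) i \<otimes> p a m"
      using inv_conj_eq tree x_in by (simp add: pS)
    then show ?case
      using step.IH by simp
  qed simp
  have step: "d (p a n) (p a (Suc n)) \<le> (1/2) ^ n / 2" for a n
    using good[of n a] tree[of a n] unfolding good_def by (simp add: pS)
  have "\<exists>l. limitin d.mtopology (p a) l sequentially" for a
  proof (rule d.halving_steps_converge[OF compl, of "p a" "\<lambda>n. (1/2) ^ n"])
    show "p a n \<in> carrier G" for n
      using tree by blast
  qed (use step in auto)
  then obtain l where l: "\<And>a. limitin d.mtopology (p a) (l a) sequentially"
    by metis
  have l_carrier: "l a \<in> carrier G" for a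
    using l d.limitin_mspace by blast
  have l_conj: "inv (l a) \<otimes> x a (Suc i) i \<otimes> l a = inv (p a (Suc i)) \<otimes> x a (Suc i) i \<otimes> p a (Suc i)" for a i
  proof -
    let ?w = "inv (p a (Suc i)) \<otimes> x a (Suc i) i \<otimes> p a (Suc i)"
    \<comment> \<open>The identity holds along the branch from height \<open>i + 1\<close> on, and it defines a closed set.\<close>
    let ?C = "{h \<in> topspace T. inv h \<otimes> x a (Suc i) i \<otimes> h \<in> {?w}}"
    have "continuous_map T T (\<lambda>h. inv h \<otimes> x a (Suc i) i \<otimes> h)"
      using x_in[of a i] continuous_map_id[unfolded id_def]
      by (intro continuous_map_group_mult continuous_map_group_inv) (simp_all add: topspace_eq)
    moreover have "closedin T {?w}"
      using x_in[of a i] tree[of a "Suc i"] unfolding T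
      by (intro closedin_Hausdorff_singleton d.Hausdorff_space_mtopology) simp
    ultimately have "closedin T ?C"
      by (rule closedin_continuous_map_preimage)
    moreover have "\<forall>\<^sub>F m in sequentially. p a m \<in> ?C"
      using eventually_ge_at_top[of "Suc i"]
    proof eventually_elim
      case (elim m)
      then show ?case
        using conj_stable[OF elim, of a] tree[of a m] topspace_eq by simp
    qed
    ultimately have "l a \<in> ?C"
      by (rule limitin_closedin[OF l[folded T] _ _ trivial_limit_sequentially])
    then show ?thesis
      by simp
  qed
  show ?thesis
  proof (rule that[OF l_carrier])
    fix a b :: "nat set" and n
    assume n: "n \<notin> a" "n \<in> b" and below: "\<And>i. i < n \<Longrightarrow> i \<in> a \<longleftrightarrow> i \<in> b"
    have eq: "p a m = p b m \<and> x a m = x b m" if "m \<le> n" for m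
      using that
    proof (induction m)
      case (Suc m)
      then show ?case using below[of m] by (simp add: pS xS)
    qed (simp add: p0 x0)
    define y z v where "y = ey n (x a n) (p a n)" and "z = ez n (x a n) (p a n)"
      and "v = ev n (x a n) (p a n)"
    have yzv: "y \<in> A" "z \<in> B" "v \<in> carrier G" "v \<otimes> y \<otimes> inv v = z"
      using good[of n a] unfolding good_def y_def z_def v_def by blast+
    have "inv (l a) \<otimes> y \<otimes> l a = inv (p a n) \<otimes> y \<otimes> p a n"
      using l_conj[of a n] n by (simp add: xS pS y_def)
    moreover have "inv (l b) \<otimes> z \<otimes> l b = inv (v \<otimes> p a n) \<otimes> z \<otimes> (v \<otimes> p a n)"
      using l_conj[of b n] n eq[of n] by (simp add: xS pS z_def v_def)
    moreover have "inv (v \<otimes> p a n) \<otimes> z \<otimes> (v \<otimes> p a n) = inv (p a n) \<otimes> y \<otimes> p a n"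
      using yzv tree A(1) by (intro inv_conj_eq) auto
    ultimately show "\<exists>y\<in>A. \<exists>z\<in>B. inv (l a) \<otimes> y \<otimes> l a = inv (l b) \<otimes> z \<otimes> l b"
      using yzv by (intro bexI[of _ y] bexI[of _ z]) simp_all
  qed
qed

end

section \<open>The small index property\<close>

theorem theorem1p6:
  fixes G :: "('a, 'b) monoid_scheme" and T :: "'a topology"
  assumes "polish_group G T"
    and "ample_generics G T"
  shows "small_index_property G T"
proof -
  interpret polish_group G T by fact
  show ?thesis
    unfolding small_index_property_def
  proof (intro allI impI, elim conjE)
    fix H assume H: "subgroup H G" and small: "rcosets\<^bsub>G\<^esub> H \<prec> (UNIV :: nat set set)"
    show "openin T H"
    proof (rule ccontr)
      assume not_open: "\<not> openin T H"
      have Hc: "H \<subseteq> carrier G"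
        using H by (rule subgroup.subset)
      have "\<not> meager_in T H"
        using meager_subgroup_continuum_index[OF H] small by blast
      moreover have "\<not> meager_in T (U \<inter> (carrier G - H))" if "openin T U" "U \<noteq> {}" for U
      proof -
        have "U \<inter> (carrier G - H) = U - H"
          using openin_subset[OF that(1)] topspace_eq by blast
        then show ?thesis
          using subgroup_open_if_comeager_in_open[OF H that] not_open by auto
      qed
      ultimately obtain p :: "nat set \<Rightarrow> 'a" where p: "\<And>a. p a \<in> carrier G"
        and meet: "\<And>a b n. n \<notin> a \<Longrightarrow> n \<in> b \<Longrightarrow> (\<And>i. i < n \<Longrightarrow> i \<in> a \<longleftrightarrow> i \<in> b) \<Longrightarrow>
          \<exists>y\<in>H. \<exists>z\<in>carrier G - H.
            inv\<^bsub>G\<^esub> (p a) \<otimes>\<^bsub>G\<^esub> y \<otimes>\<^bsub>G\<^esub> p a = inv\<^bsub>G\<^esub> (p b) \<otimes>\<^bsub>G\<^esub> z \<otimes>\<^bsub>G\<^esub> p b"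
        using generic_tree[OF assms(2) Hc, of "carrier G - H"] by blast
      have "\<not> rcosets\<^bsub>G\<^esub> H \<prec> (UNIV :: nat set set)"
      proof (rule continuum_many_rcosets[OF H p], rule notI)
        fix a b :: "nat set" and n
        \<comment> \<open>If \<open>?k \<in> H\<close>, then \<open>p a\<close> and \<open>p b\<close> conjugate \<open>H\<close> to the same subgroup, but the conjugate of \<open>y \<in> H\<close>
            by one is that of \<open>z \<notin> H\<close> by the other.\<close>
        let ?k = "p a \<otimes>\<^bsub>G\<^esub> inv\<^bsub>G\<^esub> (p b)"
        assume n: "n \<in> a" "n \<notin> b" "\<And>i. i < n \<Longrightarrow> i \<in> a \<longleftrightarrow> i \<in> b" and k: "?k \<in> H"
        have "\<exists>y\<in>H. \<exists>z\<in>carrier G - H.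
            inv\<^bsub>G\<^esub> (p b) \<otimes>\<^bsub>G\<^esub> y \<otimes>\<^bsub>G\<^esub> p b = inv\<^bsub>G\<^esub> (p a) \<otimes>\<^bsub>G\<^esub> z \<otimes>\<^bsub>G\<^esub> p a"
          by (rule meet[OF n(2,1)]) (simp add: n(3))
        then obtain y z where yz: "y \<in> H" "z \<in> carrier G" "z \<notin> H"
          and eq: "inv\<^bsub>G\<^esub> (p b) \<otimes>\<^bsub>G\<^esub> y \<otimes>\<^bsub>G\<^esub> p b = inv\<^bsub>G\<^esub> (p a) \<otimes>\<^bsub>G\<^esub> z \<otimes>\<^bsub>G\<^esub> p a"
          by blast
        have yc: "y \<in> carrier G"
          using yz(1) Hc by blast
        have "z = p a \<otimes>\<^bsub>G\<^esub> (inv\<^bsub>G\<^esub> (p a) \<otimes>\<^bsub>G\<^esub> z \<otimes>\<^bsub>G\<^esub> p a) \<otimes>\<^bsub>G\<^esub> inv\<^bsub>G\<^esub> (p a)"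
          using yz(2) p[of a] by (simp add: m_assoc) (simp flip: m_assoc)
        also have "\<dots> = ?k \<otimes>\<^bsub>G\<^esub> y \<otimes>\<^bsub>G\<^esub> inv\<^bsub>G\<^esub> ?k"
          unfolding eq[symmetric] using yc p[of a] p[of b] by (simp add: inv_mult_group m_assoc)
        also have "\<dots> \<in> H"
          using H k yz(1) by (simp add: subgroup.m_closed subgroup.m_inv_closed)
        finally show False
          using yz(3) by simp
      qed
      then show False
        using small by simp
    qed
  qed
qed

end
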